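(* Let $f\in\mathbb{R}^{\bar\Omega}$ be adapted with $f^*$ $\mathcal{F}$-measurable, and suppose that $f$ and the collection $\mathcal{U}$ of subsets of $\Omega$ satisfy the following: there exists $\lambda_0>0$ such that $$\{\lambda\mathbf{1}_U:\lambda\ge\lambda_0\}\cap\mathcal{C}\mathbf{1}_U=\varnothing\qquad\text{for all }U\in\mathcal{U},$$ and, moreover, $U,V\in\mathcal{U}$ imply $U\subset\{f^*<n\}$ for some $n$ and $U\cup V\in\mathcal{U}$. Then there exist $P\in\mathbb{P}(\mathcal{F})$ and a positive $P$-supermartingale $X$ such that $Xf$ is a $P$-quasimartingale. If there are $Q\in\mathbb{P}(\mathcal{F})$ and $\eta>0$ such that $Q(f^*<\infty)=1$ and such that $F\in\mathcal{F}$ and $Q(F\cap\{f^*<k\})\ge\eta$ imply $F\cap\{f^*<k\}\in\mathcal{U}$, then for any $\delta>\eta$ the pair $(P,X)$ above can be chosen such that $P(X_\infty=0)<\delta$.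
   Context: $\Omega$ is a set, $(\mathcal{A}_t)_{t\in\mathbb{R}_+}$ an increasing family of algebras of subsets of $\Omega$, $\mathcal{A}=\bigcup_t\mathcal{A}_t$; $\mathcal{F}$ and $\mathcal{F}_t$ are the $\sigma$-algebras generated by $\mathcal{A}$ and $\mathcal{A}_t$; $\overline{\mathbb{R}}_+=\mathbb{R}_+\cup\{\infty\}$, $\bar\Omega=\Omega\times\overline{\mathbb{R}}_+$. $\mathbb{P}(\mathcal{F})$ is the set of countably additive probabilities on $\mathcal{F}$. A function $f:\bar\Omega\to\mathbb{R}$ is adapted if $f_t=f(\cdot,t)$ is $\mathcal{F}_t$-measurable for each $t$; $f^*=\sup_{t\in\mathbb{R}_+}|f_t|$. $\mathcal{P}$ is the algebra whose elements are the finite disjoint unions $F_0\times\{0\}\cup\bigcup_{n=1}^NF_n\times]t_n,u_n]$ with $F_0\in\mathcal{A}_0$, $t_n,u_n\in\mathbb{R}_+$, $F_n\in\mathcal{A}_{t_n}$. A $\mathcal{P}$-simple function is a finite real linear combination of indicators of sets in $\mathcal{P}$; $\int h\,df$ is defined by linearity from $\int\mathbf{1}_{F_0\times\{0\}}\,df=0$ and $\int\mathbf{1}_{F\times]t,u]}\,df=\mathbf{1}_F(f_u-f_t)$. $\mathfrak{B}(\mathcal{F})_+$ is the set of nonnegative bounded $\mathcal{F}$-measurable functions. Set $$\mathcal{K}=\Big\{\int h\,df:\ h\ \mathcal{P}\text{-simple},\ |h|\le1\Big\},\qquad \mathcal{C}=\mathcal{K}-\mathfrak{B}(\mathcal{F})_+,\qquad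 \mathcal{C}\mathbf{1}_U=\{x\mathbf{1}_U:x\in\mathcal{C}\}.$$ In the statement $k$ and $n$ are positive integers. Supermartingales and quasimartingales are with respect to $(\mathcal{F}_t)$; positive means nonnegative; by the paper's convention the index set is extended to $\overline{\mathbb{R}}_+$ (with $\mathcal{F}_\infty=\mathcal{F}$), so that $X_\infty$ is the terminal element of the supermartingale $X=(X_t)_{t\in\overline{\mathbb{R}}_+}$. A process $Y=(Y_t)$ is a $P$-quasimartingale if it is adapted, each $Y_t\in L^1(P)$, and $\sup\sum_{n=1}^{N-1}E_P\big|E_P(Y_{t_{n+1}}\mid\mathcal{F}_{t_n})-Y_{t_n}\big|<\infty$, the supremum being over all finite sequences $t_1\le\dots\le t_N$ in $\mathbb{R}_+$. *)

theory Defs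
  imports "HOL-Probability.Probability"
begin

text \<open>
  Time ranges over \<open>ennreal\<close>, which plays the role of the extended half-line; \<open>t < \<infinity>\<close> says that
  \<open>t\<close> is a proper (real) time. Only the values of the family \<open>A\<close> of algebras at proper times
  matter.
\<close>

definition filt :: "'a set \<Rightarrow> (ennreal \<Rightarrow> 'a set set) \<Rightarrow> ennreal \<Rightarrow> 'a measure" where
  "filt \<Omega> A t = sigma \<Omega> (if t = \<infinity> then (\<Union>s\<in>{..<\<infinity>}. A s) else A t)"

definition adapted :: "(ennreal \<Rightarrow> 'a measure) \<Rightarrow> (ennreal \<Rightarrow> 'a \<Rightarrow> real) \<Rightarrow> bool" where
  "adapted \<F> Y \<longleftrightarrow> (\<forall>t. Y t \<in> borel_measurable (\<F> t))"

text \<open>The supremum is over proper times only, and may be infinite.\<close>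

definition maximal :: "(ennreal \<Rightarrow> 'a \<Rightarrow> real) \<Rightarrow> 'a \<Rightarrow> ennreal" where
  "maximal f \<omega> = (SUP t\<in>{..<\<infinity>}. ennreal \<bar>f t \<omega>\<bar>)"


definition pred_algebra :: "(ennreal \<Rightarrow> 'a set set) \<Rightarrow> ('a \<times> ennreal) set set" where
  "pred_algebra A = {F\<^sub>0 \<times> {0} \<union> (\<Union>n\<in>{1..N}. F n \<times> {t n<..u n}) | F\<^sub>0 (N::nat) F t u.
      F\<^sub>0 \<in> A 0 \<and> (\<forall>n\<in>{1..N}. t n < \<infinity> \<and> u n < \<infinity> \<and> F n \<in> A (t n)) \<and>
      disjoint_family_on (\<lambda>n. F n \<times> {t n<..u n}) {1..N}}"

definition pred_simple :: "(ennreal \<Rightarrow> 'a set set) \<Rightarrow> ('a \<times> ennreal \<Rightarrow> real) \<Rightarrow> bool" where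
  "pred_simple A h \<longleftrightarrow> (\<exists>(N::nat) c S. (\<forall>i<N. S i \<in> pred_algebra A) \<and>
      h = (\<lambda>z. \<Sum>i<N. c i * indicator (S i) z))"

text \<open>
  The graph of the elementary integral is the linear span of its values on rectangles. The
  restriction \<open>t \<le> u\<close> is needed: for \<open>u < t\<close> the rectangle is empty, but the formula
  for its integral need not vanish.
\<close>

inductive has_elem_integral ::
    "(ennreal \<Rightarrow> 'a set set) \<Rightarrow> (ennreal \<Rightarrow> 'a \<Rightarrow> real) \<Rightarrow> ('a \<times> ennreal \<Rightarrow> real) \<Rightarrow> ('a \<Rightarrow> real) \<Rightarrow> bool"
  for A f where
  start: "F \<in> A 0 \<Longrightarrow> has_elem_integral A f (indicator (F \<times> {0})) (\<lambda>\<omega>. 0)"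
| rect: "\<lbrakk>t \<le> u; u < \<infinity>; F \<in> A t\<rbrakk> \<Longrightarrow>
    has_elem_integral A f (indicator (F \<times> {t<..u})) (\<lambda>\<omega>. indicator F \<omega> * (f u \<omega> - f t \<omega>))"
| zero: "has_elem_integral A f (\<lambda>z. 0) (\<lambda>\<omega>. 0)"
| add: "\<lbrakk>has_elem_integral A f h x; has_elem_integral A f k y\<rbrakk> \<Longrightarrow>
    has_elem_integral A f (\<lambda>z. h z + k z) (\<lambda>\<omega>. x \<omega> + y \<omega>)"
| scale: "has_elem_integral A f h x \<Longrightarrow> has_elem_integral A f (\<lambda>z. c * h z) (\<lambda>\<omega>. c * x \<omega>)"

definition elem_integral ::
    "(ennreal \<Rightarrow> 'a set set) \<Rightarrow> (ennreal \<Rightarrow> 'a \<Rightarrow> real) \<Rightarrow> ('a \<times> ennreal \<Rightarrow> real) \<Rightarrow> 'a \<Rightarrow> real" where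
  "elem_integral A f h = (THE x. has_elem_integral A f h x)"

text \<open>
  The graph is single-valued, and every simple integrand has an integral, so the definite
  description above is meaningful. For uniqueness, the integral is recovered from \<open>h\<close> as the
  Riemann--Stieltjes sum over any sufficiently fine finite grid.
\<close>

fun grid_sum :: "(ennreal \<Rightarrow> real) \<Rightarrow> (ennreal \<Rightarrow> real) \<Rightarrow> ennreal list \<Rightarrow> real" where
  "grid_sum s g (a # b # ds) = s b * (g b - g a) + grid_sum s g (b # ds)"
| "grid_sum s g _ = 0"

lemma grid_sum_zero: "(\<And>d. d \<in> set (tl ds) \<Longrightarrow> s d = 0) \<Longrightarrow> grid_sum s g ds = 0"
  by (induction s g ds rule: grid_sum.induct) auto

lemma grid_sum_cong:
  "(\<And>d. d \<in> set (tl ds) \<Longrightarrow> s d = r d) \<Longrightarrow> grid_sum s g ds = grid_sum r g ds"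
  by (induction s g ds rule: grid_sum.induct) auto

lemma grid_sum_add: "grid_sum (\<lambda>t. s t + r t) g ds = grid_sum s g ds + grid_sum r g ds"
  by (induction s g ds rule: grid_sum.induct) (auto simp: algebra_simps)

lemma grid_sum_scale: "grid_sum (\<lambda>t. c * s t) g ds = c * grid_sum s g ds"
  by (induction s g ds rule: grid_sum.induct) (auto simp: algebra_simps)

lemma grid_sum_from_hd:
  assumes "sorted_wrt (<) (a # ds)" "u \<in> set (a # ds)"
  shows "grid_sum (indicator {a<..u}) g (a # ds) = g u - g a"
  using assms
proof (induction ds arbitrary: a)
  case (Cons b ds)
  show ?case
  proof (cases "u = a")
    case True
    then show ?thesis by (subst grid_sum_zero) auto
  next
    case False
    with Cons.prems have u: "u \<in> set (b # ds)" and ab: "a < b" and srt: "sorted_wrt (<) (b # ds)"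
      by auto
    then have bu: "b \<le> u" by auto
    have eq: "grid_sum (indicator {a<..u}) g (b # ds) = grid_sum (indicator {b<..u}) g (b # ds)"
      by (rule grid_sum_cong) (use srt ab in \<open>auto simp: indicator_def\<close>)
    show ?thesis
    proof -
      have "indicator {a<..u} b = (1::real)" using ab bu by simp
      then show ?thesis using Cons.IH[OF srt u] eq by simp
    qed
  qed
qed auto

lemma grid_sum_interval:
  assumes "sorted_wrt (<) ds" "t \<le> u" "t \<in> set ds" "u \<in> set ds"
  shows "grid_sum (indicator {t<..u}) g ds = g u - g t"
  using assms
proof (induction ds)
  case (Cons a ds)
  show ?case
  proof (cases "a = t")
    case True
    then show ?thesis using grid_sum_from_hd[of t ds u g] Cons.prems by simp
  next
    case False
    with Cons.prems have t: "t \<in> set ds" "a < t" by auto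
    with Cons.prems have u: "u \<in> set ds" by auto
    obtain b bs where ds: "ds = b # bs" using t by (cases ds) auto
    have "b \<le> t" using t Cons.prems(1) ds by auto
    then have "indicator {t<..u} b = (0::real)" by (simp add: indicator_def not_less)
    moreover have "grid_sum (indicator {t<..u}) g ds = g u - g t"
      using Cons.IH Cons.prems t u by auto
    ultimately show ?thesis using ds by simp
  qed
qed auto

lemma has_elem_integral_grid:
  assumes "has_elem_integral A f h x"
  shows "\<exists>D. finite D \<and> (\<forall>ds. sorted_wrt (<) ds \<and> D \<subseteq> set ds \<longrightarrow>
           x \<omega> = grid_sum (\<lambda>t. h (\<omega>, t)) (\<lambda>t. f t \<omega>) ds)"
  using assms
proof induction
  case (start F)
  have "grid_sum (\<lambda>t. indicator (F \<times> {0}) (\<omega>, t)) (\<lambda>t. f t \<omega>) ds = 0"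
    if "sorted_wrt (<) ds" for ds :: "ennreal list"
    by (rule grid_sum_zero, use that in \<open>cases ds\<close>) (auto simp: indicator_def)
  then show ?case by (intro exI[of _ "{}"]) auto
next
  case (rect t u F)
  have "grid_sum (\<lambda>s. indicator (F \<times> {t<..u}) (\<omega>, s)) (\<lambda>t. f t \<omega>) ds =
      indicator F \<omega> * (f u \<omega> - f t \<omega>)"
    if "sorted_wrt (<) ds" "{t, u} \<subseteq> set ds" for ds
    using grid_sum_scale[of "indicator F \<omega>" "indicator {t<..u}" "\<lambda>t. f t \<omega>" ds]
      grid_sum_interval[OF that(1) rect(1), of "\<lambda>t. f t \<omega>"] that(2)
    by (simp add: indicator_times)
  then show ?case by (intro exI[of _ "{t, u}"]) auto
next
  case zero
  then show ?case by (intro exI[of _ "{}"]) (auto simp: grid_sum_zero)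
next
  case (add h x k y)
  then obtain D E where
    "finite D" "\<forall>ds. sorted_wrt (<) ds \<and> D \<subseteq> set ds \<longrightarrow> x \<omega> = grid_sum (\<lambda>t. h (\<omega>, t)) (\<lambda>t. f t \<omega>) ds"
    "finite E" "\<forall>ds. sorted_wrt (<) ds \<and> E \<subseteq> set ds \<longrightarrow> y \<omega> = grid_sum (\<lambda>t. k (\<omega>, t)) (\<lambda>t. f t \<omega>) ds"
    by blast
  then show ?case by (intro exI[of _ "D \<union> E"]) (auto simp: grid_sum_add)
next
  case (scale h x c)
  then show ?case by (metis grid_sum_scale)
qed

lemma has_elem_integral_unique:
  assumes "has_elem_integral A f h x" "has_elem_integral A f h y"
  shows "x = y"
proof
  fix \<omega>
  obtain D E where
    "finite D" "\<forall>ds. sorted_wrt (<) ds \<and> D \<subseteq> set ds \<longrightarrow> x \<omega> = grid_sum (\<lambda>t. h (\<omega>, t)) (\<lambda>t. f t \<omega>) ds"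
    "finite E" "\<forall>ds. sorted_wrt (<) ds \<and> E \<subseteq> set ds \<longrightarrow> y \<omega> = grid_sum (\<lambda>t. h (\<omega>, t)) (\<lambda>t. f t \<omega>) ds"
    using has_elem_integral_grid[OF assms(1)] has_elem_integral_grid[OF assms(2)] by metis
  moreover from this have "sorted_wrt (<) (sorted_list_of_set (D \<union> E))"
    "set (sorted_list_of_set (D \<union> E)) = D \<union> E" by auto
  ultimately show "x \<omega> = y \<omega>" by (metis Un_upper1 Un_upper2)
qed

lemma elem_integral_eq: "has_elem_integral A f h x \<Longrightarrow> elem_integral A f h = x"
  unfolding elem_integral_def using has_elem_integral_unique by blast

lemma has_elem_integral_sum:
  assumes "finite I" "\<And>i. i \<in> I \<Longrightarrow> has_elem_integral A f (h i) (x i)"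
  shows "has_elem_integral A f (\<lambda>z. \<Sum>i\<in>I. h i z) (\<lambda>\<omega>. \<Sum>i\<in>I. x i \<omega>)"
  using assms by (induction rule: finite_induct) (auto intro: has_elem_integral.intros)

lemma pred_simple_has_elem_integral:
  assumes "pred_simple A h"
  shows "\<exists>x. has_elem_integral A f h x"
proof -
  have ind: "\<exists>x. has_elem_integral A f (indicator S) x" if "S \<in> pred_algebra A" for S
  proof -
    from that obtain F0 N F t u where S: "S = F0 \<times> {0} \<union> (\<Union>n\<in>{1..N::nat}. F n \<times> {t n<..u n})"
      and F0: "F0 \<in> A 0" and F: "\<And>n. n \<in> {1..N} \<Longrightarrow> t n < \<infinity> \<and> u n < \<infinity> \<and> F n \<in> A (t n)"
      and disj: "disjoint_family_on (\<lambda>n. F n \<times> {t n<..u n}) {1..N}"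
      unfolding pred_algebra_def by blast
    have "\<exists>x. has_elem_integral A f (indicator (F n \<times> {t n<..u n})) x" if "n \<in> {1..N}" for n
    proof (cases "t n \<le> u n")
      case True
      then show ?thesis using has_elem_integral.rect F[OF that] by blast
    next
      case False
      then have "indicator (F n \<times> {t n<..u n}) = (\<lambda>z. 0::real)" by auto
      then show ?thesis using has_elem_integral.zero by metis
    qed
    then obtain x where
      "\<And>n. n \<in> {1..N} \<Longrightarrow> has_elem_integral A f (indicator (F n \<times> {t n<..u n})) (x n)"
      by metis
    from has_elem_integral_sum[OF _ this, of "{1..N}"]
    have 1: "has_elem_integral A f (\<lambda>z. \<Sum>n\<in>{1..N}. indicator (F n \<times> {t n<..u n}) z)
        (\<lambda>\<omega>. \<Sum>n\<in>{1..N}. x n \<omega>)" by simp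
    have "indicator S = (\<lambda>z. indicator (F0 \<times> {0}) z +
        (\<Sum>n\<in>{1..N}. indicator (F n \<times> {t n<..u n}) z) :: real)"
    proof
      fix z
      have "indicator S z = indicator (F0 \<times> {0}) z +
          (indicator (\<Union>n\<in>{1..N}. F n \<times> {t n<..u n}) z :: real)"
        unfolding S by (rule indicator_disj_union) auto
      also have "indicator (\<Union>n\<in>{1..N}. F n \<times> {t n<..u n}) z =
          (\<Sum>n\<in>{1..N}. indicator (F n \<times> {t n<..u n}) z :: real)"
        by (rule indicator_UN_disjoint) (use disj in auto)
      finally show "indicator S z = indicator (F0 \<times> {0}) z +
        (\<Sum>n\<in>{1..N}. indicator (F n \<times> {t n<..u n}) z :: real)" .
    qed
    then show ?thesis using has_elem_integral.add[OF has_elem_integral.start[of F0 A f, OF F0] 1] by metis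
  qed
  from assms obtain N c S where S: "\<And>i. i < N \<Longrightarrow> S i \<in> pred_algebra A"
    and h: "h = (\<lambda>z. \<Sum>i<N::nat. c i * indicator (S i) z)" unfolding pred_simple_def by blast
  from ind[OF S] obtain x where "\<And>i. i < N \<Longrightarrow> has_elem_integral A f (indicator (S i)) (x i)"
    by metis
  then have "has_elem_integral A f h (\<lambda>\<omega>. \<Sum>i<N. c i * x i \<omega>)"
    unfolding h by (intro has_elem_integral_sum has_elem_integral.scale) auto
  then show ?thesis by blast
qed

text \<open>
  Random variables are total functions on the ambient type whose values off \<open>\<Omega>\<close> are
  irrelevant; below they are only compared after multiplication by the indicator of a subset
  of \<open>\<Omega>\<close>. Integrands vanish off \<open>\<Omega>\<close> and at time \<open>\<infinity>\<close>, so bounding them everywhere is no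
  extra restriction.
\<close>

definition gains :: "(ennreal \<Rightarrow> 'a set set) \<Rightarrow> (ennreal \<Rightarrow> 'a \<Rightarrow> real) \<Rightarrow> ('a \<Rightarrow> real) set" where
  "gains A f = {elem_integral A f h | h. pred_simple A h \<and> (\<forall>z. \<bar>h z\<bar> \<le> 1)}"

definition bounded_nonneg :: "'a measure \<Rightarrow> ('a \<Rightarrow> real) set" where
  "bounded_nonneg M = {b \<in> borel_measurable M. bounded (b ` space M) \<and> (\<forall>\<omega>\<in>space M. 0 \<le> b \<omega>)}"

definition claims :: "'a set \<Rightarrow> (ennreal \<Rightarrow> 'a set set) \<Rightarrow> (ennreal \<Rightarrow> 'a \<Rightarrow> real) \<Rightarrow> ('a \<Rightarrow> real) set" where
  "claims \<Omega> A f = {(\<lambda>\<omega>. x \<omega> - b \<omega>) | x b. x \<in> gains A f \<and> b \<in> bounded_nonneg (filt \<Omega> A \<infinity>)}"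


definition probabilities :: "'a measure \<Rightarrow> 'a measure set" where
  "probabilities M = {P. prob_space P \<and> space P = space M \<and> sets P = sets M}"

definition supermartingale ::
    "'a measure \<Rightarrow> (ennreal \<Rightarrow> 'a measure) \<Rightarrow> (ennreal \<Rightarrow> 'a \<Rightarrow> real) \<Rightarrow> bool" where
  "supermartingale P \<F> X \<longleftrightarrow> adapted \<F> X \<and> (\<forall>t. integrable P (X t)) \<and>
     (\<forall>s t. s \<le> t \<longrightarrow> (AE \<omega> in P. real_cond_exp P (\<F> s) (X t) \<omega> \<le> X s \<omega>))"

text \<open>
  Adaptedness and integrability are required up to and including \<open>\<infinity>\<close>, whereas the conditional
  variation is taken over finite sequences of proper times.
\<close>

definition quasimartingale ::
    "'a measure \<Rightarrow> (ennreal \<Rightarrow> 'a measure) \<Rightarrow> (ennreal \<Rightarrow> 'a \<Rightarrow> real) \<Rightarrow> bool" where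
  "quasimartingale P \<F> Y \<longleftrightarrow> adapted \<F> Y \<and> (\<forall>t. integrable P (Y t)) \<and>
     bdd_above {(\<Sum>n=1..<N. \<integral>\<omega>. \<bar>real_cond_exp P (\<F> (t n)) (Y (t (Suc n))) \<omega> - Y (t n) \<omega>\<bar> \<partial>P) | N t.
       mono_on {1..N} t \<and> (\<forall>n\<in>{1..N}. t n < \<infinity>)}"

end

theory Submission
  imports Defs
begin

text \<open>
  Why the theorem holds. The zero process is a positive supermartingale, so all the content is in
  the second claim, and there \<open>Q\<close> itself can serve as \<open>P\<close>.

  Let \<open>x\<close> be an elementary integral of an integrand bounded by one. If \<open>Q {l\<^sub>0 \<le> x}\<close> exceeded \<open>\<eta>\<close>,
  then for large \<open>k\<close> the set \<open>U = {l\<^sub>0 \<le> x} \<inter> {f* < k}\<close> would belong to \<open>\<U>\<close>; on it \<open>x\<close> is bounded,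
  so throwing away the bounded excess \<open>(x - l\<^sub>0) 1\<^sub>U\<close> would produce the forbidden claim \<open>l\<^sub>0 1\<^sub>U\<close>.
  Hence every gain is at most \<open>l\<^sub>0\<close> outside a set of probability \<open>\<eta>\<close> (\<open>gain_tail_bound\<close>).

  Put \<open>w = 1 / (1 + f*)\<close>, so that \<open>w x\<close> is bounded for each gain \<open>x\<close>. The tail bound says that for
  each single \<open>x\<close> there is a function \<open>z\<close> with values in \<open>[0, 1]\<close> and mean at least \<open>1 - \<eta>\<close>, namely
  the indicator of \<open>{x < l\<^sub>0}\<close>, for which \<open>E (z w x) \<le> l\<^sub>0\<close>. Both the gains and the functions
  \<open>z\<close> form convex sets, and the latter is weakly compact, so a minimax argument gives one \<open>z\<close> that
  works for all gains at once, with bound \<open>l\<^sub>0 + 1\<close> (\<open>density_bounding_weighted_expectations\<close>).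
  As \<open>z \<le> 1\<close>, its mean bounds \<open>Q {z = 0}\<close> by \<open>\<eta>\<close>.

  Let \<open>Z = z w\<close> and \<open>X\<^sub>t = E (Z | \<F>\<^sub>t)\<close> at proper times. Since \<open>X\<^sub>t f\<^sub>t = E (Z f\<^sub>t | \<F>\<^sub>t)\<close>, the
  variation of \<open>X f\<close> along a grid is \<open>E (Z \<Sum>\<^sub>n s\<^sub>n (f\<^bsub>t(n+1)\<^esub> - f\<^bsub>t(n)\<^esub>))\<close>, where \<open>s\<^sub>n\<close> is the sign of
  the \<open>n\<close>-th conditional increment. Up to an arbitrarily small error \<open>s\<^sub>n\<close> is the sign function of
  a set in the algebra at time \<open>t(n)\<close>, and then the sum is a gain, so the variation is at most
  \<open>l\<^sub>0 + 1\<close> plus that error (\<open>dual_mult_is_quasimartingale\<close>). At time \<open>\<infinity>\<close> the process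
  \<open>f\<close> is not controlled by \<open>f*\<close>; there \<open>X\<close> is lowered to \<open>Z / (1 + |f\<^bsub>\<infinity>\<^esub>|)\<close>, which preserves the
  supermartingale property and the zero set of \<open>Z\<close> while making \<open>X\<^bsub>\<infinity>\<^esub> f\<^bsub>\<infinity>\<^esub>\<close> bounded.
\<close>

section \<open>A minimax principle for finitely many affine functionals\<close>

text \<open>
  The pairs dominating some \<open>(\<phi> z, \<psi> z)\<close> form a convex subset of the plane. If it missed
  \<open>(d, d)\<close>, a separating line would single out a convex combination of \<open>\<phi>\<close> and \<open>\<psi>\<close> that
  exceeds \<open>c\<close> on all of \<open>W\<close>.
\<close>
lemma two_affine_functionals_minimax:
  fixes \<phi> \<psi> :: "('a \<Rightarrow> real) \<Rightarrow> real"
  assumes convex: "\<And>y z u. y \<in> W \<Longrightarrow> z \<in> W \<Longrightarrow> 0 \<le> u \<Longrightarrow> u \<le> 1 \<Longrightarrow>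
      (\<lambda>\<omega>. (1 - u) * y \<omega> + u * z \<omega>) \<in> W"
    and affine: "\<And>\<theta> y z u. \<theta> \<in> {\<phi>, \<psi>} \<Longrightarrow> y \<in> W \<Longrightarrow> z \<in> W \<Longrightarrow> 0 \<le> u \<Longrightarrow> u \<le> 1 \<Longrightarrow>
      \<theta> (\<lambda>\<omega>. (1 - u) * y \<omega> + u * z \<omega>) = (1 - u) * \<theta> y + u * \<theta> z"
    and segment: "\<And>u. 0 \<le> u \<Longrightarrow> u \<le> 1 \<Longrightarrow> \<exists>z\<in>W. (1 - u) * \<phi> z + u * \<psi> z \<le> c"
    and "c < d"
  shows "\<exists>z\<in>W. \<phi> z \<le> d \<and> \<psi> z \<le> d"
proof (rule ccontr)
  assume none: "\<not> ?thesis"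
  define S where "S = {(p, q) | p q. \<exists>z\<in>W. \<phi> z \<le> p \<and> \<psi> z \<le> q}"
  have "convex S"
  proof (rule convexI)
    fix a b :: "real \<times> real" and v u :: real
    assume "a \<in> S" "b \<in> S" and uv: "0 \<le> v" "0 \<le> u" "v + u = 1"
    then obtain y z where yz: "y \<in> W" "\<phi> y \<le> fst a" "\<psi> y \<le> snd a" "z \<in> W" "\<phi> z \<le> fst b" "\<psi> z \<le> snd b"
      unfolding S_def by auto
    have v: "v = 1 - u" and u: "0 \<le> u" "u \<le> 1" using uv by auto
    let ?m = "\<lambda>\<omega>. (1 - u) * y \<omega> + u * z \<omega>"
    have "?m \<in> W" using convex yz u by blast
    moreover have "\<phi> ?m \<le> v * fst a + u * fst b" "\<psi> ?m \<le> v * snd a + u * snd b"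
      using affine[of \<phi> y z u] affine[of \<psi> y z u] yz u unfolding v
      by (auto intro!: add_mono mult_left_mono)
    ultimately show "v *\<^sub>R a + u *\<^sub>R b \<in> S"
      unfolding S_def by (cases a, cases b) auto
  qed
  obtain z0 where z0: "z0 \<in> W" using segment[of 0] by auto
  then have mem: "(\<phi> z0, \<psi> z0) \<in> S" unfolding S_def by auto
  have "S \<inter> {(d, d)} = {}" using none unfolding S_def by auto
  then have "\<exists>a b. a \<noteq> 0 \<and> (\<forall>x\<in>{(d, d)}. inner a x \<le> b) \<and> (\<forall>x\<in>S. b \<le> inner a x)"
    using mem by (intro separating_hyperplane_sets[OF _ \<open>convex S\<close>]) auto
  then obtain a b where a0: "a \<noteq> 0" and ab: "\<And>s. s \<in> S \<Longrightarrow> b \<le> inner a s" "inner a (d, d) \<le> b"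
    by blast
  obtain a1 a2 where a: "a = (a1, a2)" by (cases a)
  \<comment> \<open>\<open>S\<close> is closed under increasing a coordinate, so the normal vector has no negative entry.\<close>
  have "0 \<le> a1"
  proof (rule ccontr)
    assume "\<not> 0 \<le> a1"
    define r where "r = (\<bar>a1 * \<phi> z0 + a2 * \<psi> z0 - b\<bar> + 1) / (- a1)"
    have r: "0 \<le> r" "a1 * r = - (\<bar>a1 * \<phi> z0 + a2 * \<psi> z0 - b\<bar> + 1)"
      using \<open>\<not> 0 \<le> a1\<close> unfolding r_def by (auto simp: field_simps divide_nonneg_neg divide_nonneg_pos)
    have "(\<phi> z0 + r, \<psi> z0) \<in> S" using z0 r(1) unfolding S_def by (auto intro!: bexI[of _ z0])
    from ab(1)[OF this] r(2) show False unfolding a by (simp add: algebra_simps)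
  qed
  have "0 \<le> a2"
  proof (rule ccontr)
    assume "\<not> 0 \<le> a2"
    define r where "r = (\<bar>a1 * \<phi> z0 + a2 * \<psi> z0 - b\<bar> + 1) / (- a2)"
    have r: "0 \<le> r" "a2 * r = - (\<bar>a1 * \<phi> z0 + a2 * \<psi> z0 - b\<bar> + 1)"
      using \<open>\<not> 0 \<le> a2\<close> unfolding r_def by (auto simp: field_simps divide_nonneg_neg divide_nonneg_pos)
    have "(\<phi> z0, \<psi> z0 + r) \<in> S" using z0 r(1) unfolding S_def by (auto intro!: bexI[of _ z0])
    from ab(1)[OF this] r(2) show False unfolding a by (simp add: algebra_simps)
  qed
  define s where "s = a1 + a2"
  have s: "0 < s" using a0 \<open>0 \<le> a1\<close> \<open>0 \<le> a2\<close> unfolding a s_def zero_prod_def by auto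
  define u where "u = a2 / s"
  have u: "0 \<le> u" "u \<le> 1" and su: "s * u = a2" "s * (1 - u) = a1"
    using s \<open>0 \<le> a1\<close> \<open>0 \<le> a2\<close> unfolding u_def by (auto simp: s_def field_simps)
  obtain z where z: "z \<in> W" "(1 - u) * \<phi> z + u * \<psi> z \<le> c" using segment[OF u] by auto
  have "s * d \<le> b" using ab(2) unfolding a s_def by (simp add: algebra_simps)
  also have "b \<le> a1 * \<phi> z + a2 * \<psi> z" using ab(1)[of "(\<phi> z, \<psi> z)"] z(1) unfolding a S_def by auto
  also have "\<dots> = s * ((1 - u) * \<phi> z + u * \<psi> z)" unfolding su[symmetric] by (simp add: algebra_simps)
  also have "\<dots> \<le> s * c" using z(2) s by simp
  finally show False using s \<open>c < d\<close> by simp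
qed

text \<open>
  Induction on \<open>J\<close>: replace \<open>W\<close> by the part of it on which the functional just removed is at most
  some \<open>e\<close> strictly between \<open>c\<close> and \<open>d\<close>. The case of two functionals shows that every member of
  \<open>K\<close> still falls below \<open>e\<close> somewhere on the smaller set. Each step spends some of the gap
  between \<open>c\<close> and \<open>d\<close>, which stands in for compactness of \<open>W\<close>.
\<close>
lemma finite_affine_functionals_minimax:
  fixes K :: "(('a \<Rightarrow> real) \<Rightarrow> real) set"
  assumes "finite J" "J \<subseteq> K"
    and "\<And>y z u. y \<in> W \<Longrightarrow> z \<in> W \<Longrightarrow> 0 \<le> u \<Longrightarrow> u \<le> 1 \<Longrightarrow>
      (\<lambda>\<omega>. (1 - u) * y \<omega> + u * z \<omega>) \<in> W"
    and "\<And>\<theta> y z u. \<theta> \<in> K \<Longrightarrow> y \<in> W \<Longrightarrow> z \<in> W \<Longrightarrow> 0 \<le> u \<Longrightarrow> u \<le> 1 \<Longrightarrow>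
      \<theta> (\<lambda>\<omega>. (1 - u) * y \<omega> + u * z \<omega>) = (1 - u) * \<theta> y + u * \<theta> z"
    and "\<And>\<phi> \<psi> u. \<phi> \<in> K \<Longrightarrow> \<psi> \<in> K \<Longrightarrow> 0 \<le> u \<Longrightarrow> u \<le> 1 \<Longrightarrow>
      \<exists>\<theta>\<in>K. \<forall>z\<in>W. \<theta> z = (1 - u) * \<phi> z + u * \<psi> z"
    and "\<And>\<theta>. \<theta> \<in> K \<Longrightarrow> \<exists>z\<in>W. \<theta> z \<le> c"
    and "c < d" "W \<noteq> {}"
  shows "\<exists>z\<in>W. \<forall>\<theta>\<in>J. \<theta> z \<le> d"
  using assms
proof (induction J arbitrary: W c rule: finite_induct)
  case (insert \<psi> J)
  note convex = insert.prems(2) and affine = insert.prems(3) and segment = insert.prems(4)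
    and single = insert.prems(5)
  obtain e where e: "c < e" "e < d" using dense[OF insert.prems(6)] by auto
  have \<psi>: "\<psi> \<in> K" using insert.prems(1) by auto
  define V where "V = {z \<in> W. \<psi> z \<le> e}"
  have "\<exists>z\<in>V. \<forall>\<theta>\<in>J. \<theta> z \<le> d"
  proof (rule insert.IH)
    show "J \<subseteq> K" using insert.prems(1) by auto
    show "(\<lambda>\<omega>. (1 - u) * y \<omega> + u * z \<omega>) \<in> V"
      if "y \<in> V" "z \<in> V" "0 \<le> u" "u \<le> 1" for y z u
    proof -
      have "(1 - u) * \<psi> y + u * \<psi> z \<le> (1 - u) * e + u * e"
        using that unfolding V_def by (intro add_mono mult_left_mono) auto
      then show ?thesis using that convex[of y z u] affine[OF \<psi>, of y z u]
        unfolding V_def by (auto simp: algebra_simps)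
    qed
    show "\<theta> (\<lambda>\<omega>. (1 - u) * y \<omega> + u * z \<omega>) = (1 - u) * \<theta> y + u * \<theta> z"
      if "\<theta> \<in> K" "y \<in> V" "z \<in> V" "0 \<le> u" "u \<le> 1" for \<theta> y z u
      using affine that unfolding V_def by blast
    show "\<exists>\<theta>\<in>K. \<forall>z\<in>V. \<theta> z = (1 - u) * \<phi> z + u * \<psi>' z"
      if "\<phi> \<in> K" "\<psi>' \<in> K" "0 \<le> u" "u \<le> 1" for \<phi> \<psi>' u
      using segment[OF that] unfolding V_def by blast
    show *: "\<exists>z\<in>V. \<theta> z \<le> e" if \<theta>: "\<theta> \<in> K" for \<theta>
    proof -
      have "\<exists>z\<in>W. \<theta> z \<le> e \<and> \<psi> z \<le> e"
      proof (rule two_affine_functionals_minimax[OF convex _ _ e(1)])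
        show "\<exists>z\<in>W. (1 - u) * \<theta> z + u * \<psi> z \<le> c" if u: "0 \<le> u" "u \<le> 1" for u
        proof -
          obtain \<theta>' where "\<theta>' \<in> K" "\<forall>z\<in>W. \<theta>' z = (1 - u) * \<theta> z + u * \<psi> z"
            using segment[OF \<theta> \<psi> u] by blast
          then show ?thesis using single[of \<theta>'] by force
        qed
      qed (use affine \<theta> \<psi> in auto)
      then show ?thesis unfolding V_def by blast
    qed
    show "e < d" by (rule e)
    show "V \<noteq> {}" using *[OF \<psi>] by auto
  qed
  then show ?case using e unfolding V_def by force
qed auto

section \<open>Weak compactness and approximation in measure\<close>

text \<open>
  Weak-star compactness of the unit order interval in \<open>L\<^sup>\<infinity>\<close>, for a family of half-spaces of any
  cardinality. In the Hilbert space \<open>L\<^sup>2\<close> a downward directed family of bounded closed convex sets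
  has a common point, the limit of elements of almost minimal norm: the minimal squared norm \<open>m J\<close>
  over the solutions of the finite subsystem \<open>J\<close> increases with \<open>J\<close>, and once it is close to its
  supremum \<open>s\<close>, the parallelogram law makes all almost minimal solutions of \<open>J\<close>, and of any larger
  finite subsystem, almost equal. So one sequence suffices even if \<open>H\<close> is uncountable: the condition
  \<open>(g, c)\<close> can be added to each of its finite subsystems without moving the limit.
\<close>
lemma (in finite_measure) bounded_order_interval_weakly_compact:
  fixes H :: "(('a \<Rightarrow> real) \<times> real) set"
  assumes bounded: "\<And>g c. (g, c) \<in> H \<Longrightarrow>
      g \<in> borel_measurable M \<and> (\<exists>B. \<forall>\<omega>\<in>space M. \<bar>g \<omega>\<bar> \<le> B)"
    and finite_solvable: "\<And>J. finite J \<Longrightarrow> J \<subseteq> H \<Longrightarrow>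
      \<exists>z\<in>borel_measurable M. (\<forall>\<omega>\<in>space M. 0 \<le> z \<omega> \<and> z \<omega> \<le> 1) \<and>
        (\<forall>(g, c)\<in>J. (\<integral>\<omega>. z \<omega> * g \<omega> \<partial>M) \<le> c)"
  shows "\<exists>z\<in>borel_measurable M. (\<forall>\<omega>\<in>space M. 0 \<le> z \<omega> \<and> z \<omega> \<le> 1) \<and>
        (\<forall>(g, c)\<in>H. (\<integral>\<omega>. z \<omega> * g \<omega> \<partial>M) \<le> c)"
proof -
  define I where "I = {z\<in>borel_measurable M. \<forall>\<omega>\<in>space M. 0 \<le> z \<omega> \<and> z \<omega> \<le> (1::real)}"
  define D where "D J = {z\<in>I. \<forall>(g, c)\<in>J. (\<integral>\<omega>. z \<omega> * g \<omega> \<partial>M) \<le> c}" for J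
  define N where "N z = (\<integral>\<omega>. (z \<omega>)\<^sup>2 \<partial>M)" for z :: "'a \<Rightarrow> real"
  define \<F> where "\<F> = {J. finite J \<and> J \<subseteq> H}"
  define m where "m J = Inf (N ` D J)" for J
  define s where "s = Sup (m ` \<F>)"
  have D_ne: "D J \<noteq> {}" if "J \<in> \<F>" for J
    using finite_solvable[of J] that unfolding D_def \<F>_def I_def by auto
  have D_I: "D J \<subseteq> I" for J unfolding D_def by auto
  have D_anti: "J \<subseteq> J' \<Longrightarrow> D J' \<subseteq> D J" for J J' unfolding D_def by auto
  have int: "integrable M (\<lambda>\<omega>. z \<omega> * g \<omega>)" if "z \<in> I" "g \<in> borel_measurable M"
    "\<And>\<omega>. \<omega> \<in> space M \<Longrightarrow> \<bar>g \<omega>\<bar> \<le> B" for z g B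
  proof (rule integrable_const_bound[where B=B])
    show "AE \<omega> in M. norm (z \<omega> * g \<omega>) \<le> B"
    proof (rule AE_I2)
      fix \<omega> assume "\<omega> \<in> space M"
      then have "\<bar>z \<omega>\<bar> * \<bar>g \<omega>\<bar> \<le> 1 * B"
        using that by (intro mult_mono) (auto simp: I_def)
      then show "norm (z \<omega> * g \<omega>) \<le> B" by (simp add: abs_mult)
    qed
    show "(\<lambda>\<omega>. z \<omega> * g \<omega>) \<in> borel_measurable M" using that by (auto simp: I_def)
  qed
  have int2: "integrable M (\<lambda>\<omega>. y \<omega> * z \<omega>)" if "y \<in> I" "z \<in> I" for y z
    using int[of y z 1] that by (auto simp: I_def)
  have int1: "integrable M z" if "z \<in> I" for z
    using int[OF that, of "\<lambda>_. 1" 1] by simp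
  have N_nonneg: "0 \<le> N z" for z unfolding N_def by simp
  have N_le: "N z \<le> measure M (space M)" if "z \<in> I" for z
  proof -
    have "N z \<le> (\<integral>\<omega>. 1 \<partial>M)" unfolding N_def
      using int2[OF that that] that
      by (intro integral_mono) (auto simp: I_def power2_eq_square intro: mult_le_one)
    then show ?thesis by simp
  qed
  have bdd: "bdd_below (N ` X)" for X using N_nonneg by (auto simp: bdd_below_def)
  have m_le: "m J \<le> N z" if "z \<in> D J" for J z unfolding m_def
    by (rule cInf_lower[OF _ bdd]) (use that in auto)
  have m_bdd: "m J \<le> measure M (space M)" if "J \<in> \<F>" for J
    using D_ne[OF that] m_le N_le D_I by (meson equals0I order_trans subsetD)
  have s_ge: "m J \<le> s" if "J \<in> \<F>" for J unfolding s_def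
    by (rule cSup_upper) (use that m_bdd in \<open>auto simp: bdd_above_def\<close>)
  have mid: "(\<lambda>\<omega>. (y \<omega> + z \<omega>) / 2) \<in> D J" if "y \<in> D J" "z \<in> D J" "J \<subseteq> H" for y z J
  proof -
    have yz: "y \<in> I" "z \<in> I" using that D_I by auto
    have "(\<integral>\<omega>. (y \<omega> + z \<omega>) / 2 * g \<omega> \<partial>M) \<le> c" if gc: "(g, c) \<in> J" for g c
    proof -
      obtain B where g: "g \<in> borel_measurable M" "\<forall>\<omega>\<in>space M. \<bar>g \<omega>\<bar> \<le> B"
        using bounded[of g c] gc \<open>J \<subseteq> H\<close> by auto
      have i: "integrable M (\<lambda>\<omega>. y \<omega> * g \<omega>)" "integrable M (\<lambda>\<omega>. z \<omega> * g \<omega>)"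
        using g by (auto intro!: int[OF yz(1), of _ B] int[OF yz(2), of _ B])
      have "(\<integral>\<omega>. (y \<omega> + z \<omega>) / 2 * g \<omega> \<partial>M) = (\<integral>\<omega>. (y \<omega> * g \<omega> + z \<omega> * g \<omega>) / 2 \<partial>M)"
        by (simp add: algebra_simps)
      also have "\<dots> = ((\<integral>\<omega>. y \<omega> * g \<omega> \<partial>M) + (\<integral>\<omega>. z \<omega> * g \<omega> \<partial>M)) / 2"
        using i by simp
      also have "\<dots> \<le> c" using that(1) gc \<open>y \<in> D J\<close> \<open>z \<in> D J\<close> unfolding D_def by force
      finally show ?thesis .
    qed
    moreover have "(\<lambda>\<omega>. (y \<omega> + z \<omega>) / 2) \<in> I" using yz unfolding I_def by force
    ultimately show ?thesis unfolding D_def by auto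
  qed
  have parallelogram: "(\<integral>\<omega>. (y \<omega> - z \<omega>)\<^sup>2 \<partial>M) \<le> 8 * e"
    if J: "J \<in> \<F>" "s - e \<le> m J" and y: "y \<in> D J" "N y \<le> s + e" and z: "z \<in> D J" "N z \<le> s + e"
    for y z J e
  proof -
    have yz: "y \<in> I" "z \<in> I" using that D_I by auto
    let ?h = "\<lambda>\<omega>. (y \<omega> + z \<omega>) / 2"
    have h: "?h \<in> D J" using mid J y z unfolding \<F>_def by auto
    have hI: "?h \<in> I" using h D_I by auto
    have i: "integrable M (\<lambda>\<omega>. (y \<omega>)\<^sup>2)" "integrable M (\<lambda>\<omega>. (z \<omega>)\<^sup>2)" "integrable M (\<lambda>\<omega>. (?h \<omega>)\<^sup>2)"
      using int2[OF yz(1) yz(1)] int2[OF yz(2) yz(2)] int2[OF hI hI] by (simp_all only: power2_eq_square)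
    have "(\<integral>\<omega>. (y \<omega> - z \<omega>)\<^sup>2 \<partial>M) = (\<integral>\<omega>. 2 * (y \<omega>)\<^sup>2 + 2 * (z \<omega>)\<^sup>2 - 4 * (?h \<omega>)\<^sup>2 \<partial>M)"
      by (intro Bochner_Integration.integral_cong) (auto simp: power2_eq_square field_simps)
    also have "\<dots> = 2 * N y + 2 * N z - 4 * N ?h" unfolding N_def using i by simp
    also have "\<dots> \<le> 8 * e" using m_le[OF h] J(2) y(2) z(2) by simp
    finally show ?thesis .
  qed
  have L1: "(\<integral>\<omega>. \<bar>y \<omega> - z \<omega>\<bar> \<partial>M) \<le> e * (measure M (space M) + 8)"
    if e: "0 < e" and J: "J \<in> \<F>" "s - e\<^sup>2 \<le> m J" and y: "y \<in> D J" "N y \<le> s + e\<^sup>2"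
      and z: "z \<in> D J" "N z \<le> s + e\<^sup>2"
    for y z J e
  proof -
    have yz: "y \<in> I" "z \<in> I" using that D_I by auto
    have i: "integrable M (\<lambda>\<omega>. (y \<omega> - z \<omega>)\<^sup>2)"
      using int2[OF yz(1) yz(1)] int2[OF yz(2) yz(2)] int2[OF yz(1) yz(2)]
      by (simp add: power2_diff) (simp add: power2_eq_square mult.assoc)
    \<comment> \<open>Young's inequality: \<open>\<bar>a\<bar> \<le> e + a\<^sup>2 / e\<close>.\<close>
    have young: "\<bar>a\<bar> \<le> e + a\<^sup>2 / e" for a :: real
    proof -
      have "0 \<le> (\<bar>a\<bar> - e)\<^sup>2 + \<bar>a\<bar> * e" using e by simp
      then show ?thesis using e by (simp add: field_simps power2_eq_square)
    qed
    have "(\<integral>\<omega>. \<bar>y \<omega> - z \<omega>\<bar> \<partial>M) \<le> (\<integral>\<omega>. e + (y \<omega> - z \<omega>)\<^sup>2 / e \<partial>M)"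
      using i int1[OF yz(1)] int1[OF yz(2)] young by (intro integral_mono) auto
    also have "\<dots> = e * measure M (space M) + (\<integral>\<omega>. (y \<omega> - z \<omega>)\<^sup>2 \<partial>M) / e" using i by simp
    also have "\<dots> \<le> e * measure M (space M) + 8 * e\<^sup>2 / e"
      using parallelogram[OF J y z] e by (intro add_left_mono divide_right_mono) auto
    also have "\<dots> = e * (measure M (space M) + 8)" using e by (simp add: power2_eq_square algebra_simps)
    finally show ?thesis .
  qed
  define e :: "nat \<Rightarrow> real" where "e n = inverse (real (Suc n))" for n
  have e_pos: "0 < e n" for n unfolding e_def by simp
  have e_mono: "(e n)\<^sup>2 \<le> (e k)\<^sup>2" if "k \<le> n" for n k
    using that unfolding e_def by (intro power_mono le_imp_inverse_le) auto
  have e_lim: "e \<longlonglongrightarrow> 0" unfolding e_def by (rule LIMSEQ_inverse_real_of_nat)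
  have "\<exists>J\<in>\<F>. s - (e n)\<^sup>2 < m J" for n
  proof -
    have "m ` \<F> \<noteq> {}" unfolding \<F>_def by auto
    moreover have "s - (e n)\<^sup>2 < Sup (m ` \<F>)" using e_pos[of n] unfolding s_def by simp
    ultimately have "\<exists>x\<in>m ` \<F>. s - (e n)\<^sup>2 < x" by (rule less_cSupD)
    then show ?thesis by blast
  qed
  then obtain J0 where J0: "\<And>n. J0 n \<in> \<F>" "\<And>n. s - (e n)\<^sup>2 < m (J0 n)" by metis
  define J where "J n = (\<Union>k\<le>n. J0 k)" for n
  have J: "J n \<in> \<F>" for n using J0(1) unfolding J_def \<F>_def by auto
  have J_mono: "J k \<subseteq> J n" if "k \<le> n" for k n using that unfolding J_def by force
  have m_mono: "m X \<le> m Y" if "X \<subseteq> Y" "Y \<in> \<F>" for X Y unfolding m_def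
    using D_ne[OF that(2)] bdd D_anti[OF that(1)] by (intro cInf_superset_mono image_mono) auto
  have mJ: "s - (e n)\<^sup>2 \<le> m (J n)" for n
    using J0(2)[of n] m_mono[of "J0 n" "J n"] J[of n] unfolding J_def by force
  have near: "\<exists>z\<in>D X. N z \<le> s + (e n)\<^sup>2" if "X \<in> \<F>" for X n
  proof -
    have "Inf (N ` D X) < s + (e n)\<^sup>2" using s_ge[OF that] e_pos[of n] unfolding m_def
      by (smt (verit) zero_less_power)
    then show ?thesis using cInf_lessD[of "N ` D X"] D_ne[OF that] by force
  qed
  \<comment> \<open>Almost minimal solutions of the increasing subsystems \<open>J n\<close>.\<close>
  have "\<exists>z. \<forall>n. z n \<in> D (J n) \<and> N (z n) \<le> s + (e n)\<^sup>2"
    by (rule choice) (use near[OF J] in blast)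
  then obtain z where z: "\<And>n. z n \<in> D (J n)" "\<And>n. N (z n) \<le> s + (e n)\<^sup>2" by blast
  have zI: "z n \<in> I" for n using z D_I by auto
  let ?C = "measure M (space M) + 8"
  have eC_lim: "(\<lambda>n. e n * ?C) \<longlonglongrightarrow> 0" by (rule tendsto_mult_left_zero[OF e_lim])
  have z_cauchy: "(\<integral>\<omega>. norm (z i \<omega> - z j \<omega>) \<partial>M) \<le> e n * ?C" if "n \<le> i" "n \<le> j" for n i j
    using L1[OF e_pos J mJ, of "z i" n "z j"] z(1)[of i] z(1)[of j] z(2)[of i] z(2)[of j]
      D_anti[OF J_mono[OF that(1)]] D_anti[OF J_mono[OF that(2)]] e_mono[OF that(1)] e_mono[OF that(2)]
    by force
  obtain r where r: "strict_mono r" "AE \<omega> in M. Cauchy (\<lambda>i. z (r i) \<omega>)"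
  proof (rule cauchy_L1_AE_cauchy_subseq[of M z])
    show "integrable M (z n)" for n using int1 zI by auto
    fix \<epsilon> :: real assume "0 < \<epsilon>"
    then obtain n where "e n * ?C < \<epsilon>"
      using order_tendstoD(2)[OF eC_lim] by (auto simp: eventually_sequentially)
    then show "\<exists>n. \<forall>i\<ge>n. \<forall>j\<ge>n. (\<integral>\<omega>. norm (z i \<omega> - z j \<omega>) \<partial>M) < \<epsilon>"
      using z_cauchy by (meson order_le_less_trans)
  qed
  \<comment> \<open>Truncation makes the limit take values in the unit interval also where the subsequence
     diverges.\<close>
  define Z where "Z \<omega> = max 0 (min 1 (lim (\<lambda>i. z (r i) \<omega>)))" for \<omega>
  have z_meas[measurable]: "z n \<in> borel_measurable M" for n using zI unfolding I_def by auto
  have Z_meas[measurable]: "Z \<in> borel_measurable M" unfolding Z_def by measurable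
  have Z_lim: "AE \<omega> in M. (\<lambda>i. z (r i) \<omega>) \<longlonglongrightarrow> Z \<omega>"
    using r(2) AE_space
  proof eventually_elim
    fix \<omega> assume "Cauchy (\<lambda>i. z (r i) \<omega>)" "\<omega> \<in> space M"
    then have l: "(\<lambda>i. z (r i) \<omega>) \<longlonglongrightarrow> lim (\<lambda>i. z (r i) \<omega>)"
      using Cauchy_convergent convergent_LIMSEQ_iff by blast
    have "0 \<le> lim (\<lambda>i. z (r i) \<omega>)" "lim (\<lambda>i. z (r i) \<omega>) \<le> 1"
      using LIMSEQ_le_const[OF l] LIMSEQ_le_const2[OF l] zI \<open>\<omega> \<in> space M\<close> unfolding I_def by auto
    then show "(\<lambda>i. z (r i) \<omega>) \<longlonglongrightarrow> Z \<omega>" using l unfolding Z_def by simp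
  qed
  have "(\<integral>\<omega>. Z \<omega> * g \<omega> \<partial>M) \<le> c" if gc: "(g, c) \<in> H" for g c
  proof -
    obtain B0 where g[measurable]: "g \<in> borel_measurable M" and B0: "\<forall>\<omega>\<in>space M. \<bar>g \<omega>\<bar> \<le> B0"
      using bounded[of g c] gc by auto
    define B where "B = max 0 B0"
    have "0 \<le> B" and B: "\<And>\<omega>. \<omega> \<in> space M \<Longrightarrow> \<bar>g \<omega>\<bar> \<le> B" using B0 unfolding B_def by force+
    have lim: "(\<lambda>i. \<integral>\<omega>. z (r i) \<omega> * g \<omega> \<partial>M) \<longlonglongrightarrow> (\<integral>\<omega>. Z \<omega> * g \<omega> \<partial>M)"
    proof (rule integral_dominated_convergence[where w="\<lambda>_. B"])
      show "AE \<omega> in M. (\<lambda>i. z (r i) \<omega> * g \<omega>) \<longlonglongrightarrow> Z \<omega> * g \<omega>"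
        using Z_lim by eventually_elim (intro tendsto_intros)
      show "AE \<omega> in M. norm (z (r i) \<omega> * g \<omega>) \<le> B" for i
      proof (rule AE_I2)
        fix \<omega> assume "\<omega> \<in> space M"
        then have "\<bar>z (r i) \<omega>\<bar> * \<bar>g \<omega>\<bar> \<le> 1 * B"
          using zI[of "r i"] B by (intro mult_mono) (auto simp: I_def)
        then show "norm (z (r i) \<omega> * g \<omega>) \<le> B" by (simp add: abs_mult)
      qed
    qed auto
    \<comment> \<open>\<open>z n\<close> need not satisfy \<open>(g, c)\<close>, but it is close to an almost minimal solution \<open>y\<close> of the
       subsystem enlarged by \<open>(g, c)\<close>.\<close>
    have "(\<integral>\<omega>. z n \<omega> * g \<omega> \<partial>M) \<le> c + B * (e n * ?C)" for n
    proof -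
      have "insert (g, c) (J n) \<in> \<F>" using J[of n] gc unfolding \<F>_def by auto
      then obtain y where y: "y \<in> D (insert (g, c) (J n))" "N y \<le> s + (e n)\<^sup>2" using near by blast
      then have yD: "y \<in> D (J n)" and yI: "y \<in> I" and yc: "(\<integral>\<omega>. y \<omega> * g \<omega> \<partial>M) \<le> c"
        unfolding D_def by auto
      have ig: "integrable M (\<lambda>\<omega>. z n \<omega> * g \<omega>)" "integrable M (\<lambda>\<omega>. y \<omega> * g \<omega>)"
        using int[OF zI g B] int[OF yI g B] by auto
      have id: "integrable M (\<lambda>\<omega>. \<bar>z n \<omega> - y \<omega>\<bar>)" using int1[OF yI] int1[OF zI[of n]] by auto
      have "(\<integral>\<omega>. z n \<omega> * g \<omega> \<partial>M) - (\<integral>\<omega>. y \<omega> * g \<omega> \<partial>M) = (\<integral>\<omega>. (z n \<omega> - y \<omega>) * g \<omega> \<partial>M)"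
        using ig by (simp add: algebra_simps)
      also have "\<dots> \<le> (\<integral>\<omega>. B * \<bar>z n \<omega> - y \<omega>\<bar> \<partial>M)"
      proof (rule integral_mono)
        show "integrable M (\<lambda>\<omega>. (z n \<omega> - y \<omega>) * g \<omega>)" using ig by (simp add: algebra_simps)
        show "integrable M (\<lambda>\<omega>. B * \<bar>z n \<omega> - y \<omega>\<bar>)" using id by simp
        fix \<omega> assume "\<omega> \<in> space M"
        have "(z n \<omega> - y \<omega>) * g \<omega> \<le> \<bar>z n \<omega> - y \<omega>\<bar> * \<bar>g \<omega>\<bar>" by (simp flip: abs_mult)
        also have "\<dots> \<le> B * \<bar>z n \<omega> - y \<omega>\<bar>" using B[OF \<open>\<omega> \<in> space M\<close>]
          by (simp add: mult.commute mult_right_mono)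
        finally show "(z n \<omega> - y \<omega>) * g \<omega> \<le> B * \<bar>z n \<omega> - y \<omega>\<bar>" .
      qed
      also have "\<dots> = B * (\<integral>\<omega>. \<bar>z n \<omega> - y \<omega>\<bar> \<partial>M)" by simp
      also have "\<dots> \<le> B * (e n * ?C)"
        using L1[OF e_pos J mJ z yD y(2)] \<open>0 \<le> B\<close> by (rule mult_left_mono)
      finally show ?thesis using yc by linarith
    qed
    then have "(\<integral>\<omega>. z (r i) \<omega> * g \<omega> \<partial>M) \<le> c + B * (e (r i) * ?C)" for i .
    moreover have "(\<lambda>i. c + B * (e (r i) * ?C)) \<longlonglongrightarrow> c + B * 0"
      by (intro tendsto_intros LIMSEQ_subseq_LIMSEQ[OF eC_lim r(1), unfolded comp_def])
    ultimately show ?thesis using lim LIMSEQ_le[OF lim] by force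
  qed
  moreover have "0 \<le> Z \<omega> \<and> Z \<omega> \<le> 1" for \<omega> unfolding Z_def by simp
  ultimately show ?thesis using Z_meas by blast
qed

text \<open>
  The sets that can be approximated from \<open>G\<close> form a \<open>\<sigma>\<close>-algebra: a countable union differs little
  from a finite partial union, whose members are approximated one by one.
\<close>
lemma (in finite_measure) sigma_sets_approximation:
  assumes G: "algebra (space M) G" "G \<subseteq> sets M"
    and "B \<in> sigma_sets (space M) G" "0 < \<epsilon>"
  shows "\<exists>C\<in>G. measure M (sym_diff B C) < \<epsilon>"
  using assms(3,4)
proof (induction arbitrary: \<epsilon>)
  interpret algebra "space M" G by (rule G)
  have sub: "X \<in> sets M" if "X \<in> sigma_sets (space M) G" for X
    using that sets.sigma_sets_subset[OF G(2)] by auto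
  {
    case (Basic a)
    then show ?case by (intro bexI[of _ a]) auto
  next
    case Empty
    then show ?case by (intro bexI[of _ "{}"]) auto
  next
    case (Compl a)
    then obtain C where C: "C \<in> G" "measure M (sym_diff a C) < \<epsilon>" by blast
    have "sym_diff (space M - a) (space M - C) = sym_diff a C"
      using sets.sets_into_space[OF sub[OF Compl.hyps]] sets_into_space[OF C(1)] by auto
    then show ?case using C by (intro bexI[of _ "space M - C"]) auto
  next
    case (Union a)
    have a[measurable]: "a i \<in> sets M" for i using sub Union.hyps by auto
    have "(\<lambda>n. measure M (\<Union>i\<le>n. a i)) \<longlonglongrightarrow> measure M (\<Union>n. \<Union>i\<le>n. a i)"
      by (rule finite_Lim_measure_incseq) (auto simp: incseq_def, force)
    moreover have "(\<Union>n. \<Union>i\<le>n. a i) = (\<Union>i. a i)" by auto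
    ultimately have "(\<lambda>n. measure M (\<Union>i. a i) - measure M (\<Union>i\<le>n. a i)) \<longlonglongrightarrow> 0"
      using tendsto_diff[OF tendsto_const[of "measure M (\<Union>i. a i)"]] by force
    then have "eventually (\<lambda>n. measure M (\<Union>i. a i) - measure M (\<Union>i\<le>n. a i) < \<epsilon> / 2) sequentially"
      by (rule order_tendstoD(2)) (use Union.prems in simp)
    then obtain n where n: "measure M (\<Union>i. a i) - measure M (\<Union>i\<le>n. a i) < \<epsilon> / 2"
      using eventually_happens sequentially_bot by blast
    have "\<exists>C\<in>G. measure M (sym_diff (a i) C) < \<epsilon> / (2 * Suc n)" for i
      using Union.IH[of "\<epsilon> / (2 * Suc n)" i] Union.prems by simp
    then obtain C where C: "\<And>i. C i \<in> G" "\<And>i. measure M (sym_diff (a i) (C i)) < \<epsilon> / (2 * Suc n)"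
      by metis
    have CM[measurable]: "C i \<in> sets M" for i using C(1) G(2) by auto
    let ?T = "(\<Union>i. a i) - (\<Union>i\<le>n. a i)" and ?S = "\<Union>i\<le>n. sym_diff (a i) (C i)"
    have "measure M (sym_diff (\<Union>i. a i) (\<Union>i\<le>n. C i)) \<le> measure M (?T \<union> ?S)"
      by (rule finite_measure_mono) auto
    also have "\<dots> \<le> measure M ?T + measure M ?S" by (rule measure_Un_le) auto
    also have "measure M ?T = measure M (\<Union>i. a i) - measure M (\<Union>i\<le>n. a i)"
      by (rule finite_measure_Diff) auto
    also have "measure M ?S \<le> (\<Sum>i\<le>n. measure M (sym_diff (a i) (C i)))"
      by (rule finite_measure_subadditive_finite) auto
    also have "\<dots> \<le> (\<Sum>i\<le>n. \<epsilon> / (2 * Suc n))" using C(2) by (intro sum_mono) (auto intro: less_imp_le)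
    also have "\<dots> = \<epsilon> / 2" by (simp add: field_simps)
    finally have "measure M (sym_diff (\<Union>i. a i) (\<Union>i\<le>n. C i)) < \<epsilon>" using n by simp
    moreover have "(\<Union>i\<le>n. C i) \<in> G" using C(1) by auto
    ultimately show ?case by blast
  }
qed

section \<open>A density that bounds a convex set\<close>

text \<open>
  A form of Yan's theorem on convex sets bounded in probability. A tail bound for each
  element separately is turned into a common density \<open>z\<close>, at the price of losing mass at most
  \<open>\<eta>\<close>. The weight \<open>w\<close> makes the elements integrable. In the proof, \<open>W\<close> is the
  set of candidate densities, and the mean condition on \<open>z\<close> is encoded in \<open>H\<close> as the half-space
  \<open>E (z \<cdot> (-1)) \<le> \<eta> - 1\<close>.
\<close>
lemma (in prob_space) density_bounding_weighted_expectations: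
  fixes C :: "('a \<Rightarrow> real) set"
  assumes convex: "\<And>x y u. x \<in> C \<Longrightarrow> y \<in> C \<Longrightarrow> 0 \<le> u \<Longrightarrow> u \<le> 1 \<Longrightarrow>
      (\<lambda>\<omega>. (1 - u) * x \<omega> + u * y \<omega>) \<in> C"
    and C_meas: "\<And>x. x \<in> C \<Longrightarrow> x \<in> borel_measurable M"
    and w_meas[measurable]: "w \<in> borel_measurable M" and w: "\<And>\<omega>. 0 \<le> w \<omega> \<and> w \<omega> \<le> 1"
    and bounded: "\<And>x. x \<in> C \<Longrightarrow> \<exists>B. \<forall>\<omega>\<in>space M. \<bar>w \<omega> * x \<omega>\<bar> \<le> B"
    and tail: "\<And>x. x \<in> C \<Longrightarrow> prob {\<omega>\<in>space M. l \<le> x \<omega>} \<le> \<eta>"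
    and "0 < l" "0 < \<eta>"
  shows "\<exists>z\<in>borel_measurable M. (\<forall>\<omega>\<in>space M. 0 \<le> z \<omega> \<and> z \<omega> \<le> 1) \<and>
      1 - \<eta> \<le> expectation z \<and> (\<forall>x\<in>C. (\<integral>\<omega>. z \<omega> * (w \<omega> * x \<omega>) \<partial>M) \<le> l + 1)"
proof -
  define W where "W = {z\<in>borel_measurable M. (\<forall>\<omega>\<in>space M. 0 \<le> z \<omega> \<and> z \<omega> \<le> (1::real)) \<and>
    1 - \<eta> \<le> expectation z}"
  define F where "F g z = (\<integral>\<omega>. z \<omega> * g \<omega> \<partial>M)" for g z :: "'a \<Rightarrow> real"
  define G where "G = (\<lambda>x \<omega>. w \<omega> * x \<omega>) ` C"
  define H where "H = insert (\<lambda>_. -1, \<eta> - 1) ((\<lambda>g. (g, l + 1)) ` G)"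
  have G: "g \<in> borel_measurable M \<and> (\<exists>B. \<forall>\<omega>\<in>space M. \<bar>g \<omega>\<bar> \<le> B)" if "g \<in> G" for g
    using that C_meas bounded unfolding G_def by auto
  have int: "integrable M (\<lambda>\<omega>. z \<omega> * g \<omega>)" if z: "z \<in> W" and "g \<in> G" for z g
  proof -
    obtain B where g: "g \<in> borel_measurable M" "\<forall>\<omega>\<in>space M. \<bar>g \<omega>\<bar> \<le> B" using G \<open>g \<in> G\<close> by auto
    show ?thesis
    proof (rule integrable_const_bound[where B=B])
      show "AE \<omega> in M. norm (z \<omega> * g \<omega>) \<le> B"
      proof (rule AE_I2)
        fix \<omega> assume "\<omega> \<in> space M"
        then have "\<bar>z \<omega>\<bar> * \<bar>g \<omega>\<bar> \<le> 1 * B" using z g by (intro mult_mono) (auto simp: W_def)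
        then show "norm (z \<omega> * g \<omega>) \<le> B" by (simp add: abs_mult)
      qed
    qed (use z g in \<open>auto simp: W_def\<close>)
  qed
  have int1: "integrable M z" if "z \<in> W" for z
    by (rule integrable_const_bound[where B=1]) (use that in \<open>auto simp: W_def intro!: AE_I2\<close>)
  have W_convex: "(\<lambda>\<omega>. (1 - u) * y \<omega> + u * z \<omega>) \<in> W"
    if yz: "y \<in> W" "z \<in> W" and u: "0 \<le> u" "u \<le> 1" for y z u
  proof -
    have "expectation (\<lambda>\<omega>. (1 - u) * y \<omega> + u * z \<omega>) = (1 - u) * expectation y + u * expectation z"
      using int1[OF yz(1)] int1[OF yz(2)] by simp
    moreover have "(1 - u) * (1 - \<eta>) + u * (1 - \<eta>) \<le> (1 - u) * expectation y + u * expectation z"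
      using yz u by (intro add_mono mult_left_mono) (auto simp: W_def)
    ultimately have "1 - \<eta> \<le> expectation (\<lambda>\<omega>. (1 - u) * y \<omega> + u * z \<omega>)" by (simp add: algebra_simps)
    moreover have "0 \<le> (1 - u) * y \<omega> + u * z \<omega> \<and> (1 - u) * y \<omega> + u * z \<omega> \<le> 1"
      if "\<omega> \<in> space M" for \<omega>
    proof -
      have "(1 - u) * y \<omega> + u * z \<omega> \<le> (1 - u) * 1 + u * 1"
        using yz u that by (intro add_mono mult_left_mono) (auto simp: W_def)
      then show ?thesis using yz u that by (auto simp: W_def)
    qed
    ultimately show ?thesis using yz unfolding W_def by auto
  qed
  \<comment> \<open>Against a single \<open>x\<close>, the indicator of the set where \<open>x\<close> is below \<open>l\<close> does the job.\<close>
  have single: "\<exists>z\<in>W. F g z \<le> l" if g: "g \<in> G" for g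
  proof -
    obtain x where x: "x \<in> C" "g = (\<lambda>\<omega>. w \<omega> * x \<omega>)" using g unfolding G_def by blast
    have [measurable]: "x \<in> borel_measurable M" using C_meas x by auto
    let ?z = "indicator {\<omega>\<in>space M. x \<omega> < l} :: 'a \<Rightarrow> real"
    have "{\<omega>\<in>space M. x \<omega> < l} = space M - {\<omega>\<in>space M. l \<le> x \<omega>}" by auto
    then have "prob {\<omega>\<in>space M. x \<omega> < l} = 1 - prob {\<omega>\<in>space M. l \<le> x \<omega>}"
      by (simp add: prob_compl)
    then have "?z \<in> W" using tail[OF x(1)] unfolding W_def by (auto simp: indicator_def)
    moreover have "F g ?z \<le> l"
    proof -
      have "F g ?z \<le> (\<integral>\<omega>. l \<partial>M)" unfolding F_def
      proof (rule integral_mono[OF int[OF \<open>?z \<in> W\<close> g]])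
        fix \<omega> assume "\<omega> \<in> space M"
        have "w \<omega> * x \<omega> \<le> l" if "x \<omega> < l"
        proof -
          have "w \<omega> * x \<omega> \<le> w \<omega> * l" using w that by (intro mult_left_mono) auto
          also have "\<dots> \<le> l" using w[of \<omega>] \<open>0 < l\<close> by (intro mult_left_le_one_le) auto
          finally show ?thesis .
        qed
        then show "?z \<omega> * g \<omega> \<le> l" using \<open>0 < l\<close> x(2) by (auto simp: indicator_def)
      qed simp
      then show ?thesis by (simp add: prob_space)
    qed
    ultimately show ?thesis by blast
  qed
  have "(\<lambda>_. 1) \<in> W" using \<open>0 < \<eta>\<close> unfolding W_def by (auto simp: prob_space)
  then have W_ne: "W \<noteq> {}" by blast
  have "\<exists>z\<in>borel_measurable M. (\<forall>\<omega>\<in>space M. 0 \<le> z \<omega> \<and> z \<omega> \<le> 1) \<and>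
        (\<forall>(g, c)\<in>H. (\<integral>\<omega>. z \<omega> * g \<omega> \<partial>M) \<le> c)"
  proof (rule bounded_order_interval_weakly_compact)
    show "g \<in> borel_measurable M \<and> (\<exists>B. \<forall>\<omega>\<in>space M. \<bar>g \<omega>\<bar> \<le> B)" if "(g, c) \<in> H" for g c
      using that G unfolding H_def by auto
    fix J assume J: "finite J" "J \<subseteq> H"
    have "\<exists>z\<in>W. \<forall>\<theta>\<in>F ` (fst ` J \<inter> G). \<theta> z \<le> l + 1"
    proof (rule finite_affine_functionals_minimax[where K = "F ` G" and c = l])
      show "finite (F ` (fst ` J \<inter> G))" "F ` (fst ` J \<inter> G) \<subseteq> F ` G" using J by auto
      show "\<theta> (\<lambda>\<omega>. (1 - u) * y \<omega> + u * z \<omega>) = (1 - u) * \<theta> y + u * \<theta> z"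
        if \<theta>: "\<theta> \<in> F ` G" and yz: "y \<in> W" "z \<in> W" for \<theta> y z u
      proof -
        obtain g where g: "g \<in> G" "\<theta> = F g" using \<theta> by blast
        have "((1 - u) * y \<omega> + u * z \<omega>) * g \<omega> = (1 - u) * (y \<omega> * g \<omega>) + u * (z \<omega> * g \<omega>)" for \<omega>
          by (simp add: algebra_simps)
        then show ?thesis using int[OF yz(1) g(1)] int[OF yz(2) g(1)] unfolding g(2) F_def by simp
      qed
      show "\<exists>\<theta>\<in>F ` G. \<forall>z\<in>W. \<theta> z = (1 - u) * \<phi> z + u * \<psi> z"
        if \<phi>\<psi>: "\<phi> \<in> F ` G" "\<psi> \<in> F ` G" and u: "0 \<le> u" "u \<le> 1" for \<phi> \<psi> u
      proof -
        obtain x y where xy: "x \<in> C" "\<phi> = F (\<lambda>\<omega>. w \<omega> * x \<omega>)" "y \<in> C" "\<psi> = F (\<lambda>\<omega>. w \<omega> * y \<omega>)"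
          using \<phi>\<psi> unfolding G_def by blast
        define v where "v \<omega> = (1 - u) * x \<omega> + u * y \<omega>" for \<omega>
        have "v \<in> C" unfolding v_def using convex xy(1,3) u by blast
        moreover have "F (\<lambda>\<omega>. w \<omega> * v \<omega>) z = (1 - u) * \<phi> z + u * \<psi> z" if "z \<in> W" for z
        proof -
          have "integrable M (\<lambda>\<omega>. z \<omega> * (w \<omega> * x \<omega>))" "integrable M (\<lambda>\<omega>. z \<omega> * (w \<omega> * y \<omega>))"
            using int[OF that] xy unfolding G_def by auto
          moreover have "z \<omega> * (w \<omega> * v \<omega>) = (1 - u) * (z \<omega> * (w \<omega> * x \<omega>)) + u * (z \<omega> * (w \<omega> * y \<omega>))" for \<omega>
            unfolding v_def by (simp add: algebra_simps)
          ultimately show ?thesis unfolding xy F_def by simp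
        qed
        ultimately show ?thesis unfolding G_def by blast
      qed
      show "\<exists>z\<in>W. \<theta> z \<le> l" if "\<theta> \<in> F ` G" for \<theta> using that single by auto
    qed (use W_convex W_ne in auto)
    then obtain z where z: "z \<in> W" "\<And>g. g \<in> fst ` J \<Longrightarrow> g \<in> G \<Longrightarrow> F g z \<le> l + 1" by auto
    have "(\<integral>\<omega>. z \<omega> * g \<omega> \<partial>M) \<le> c" if gc: "(g, c) \<in> J" for g c
    proof -
      have "(g, c) \<in> H" using gc J by auto
      then consider "g = (\<lambda>_. -1)" "c = \<eta> - 1" | "g \<in> G" "c = l + 1" unfolding H_def by auto
      then show ?thesis
      proof cases
        case 1
        then show ?thesis using z(1) unfolding W_def by simp
      next
        case 2
        then show ?thesis using z(2)[of g] gc unfolding F_def by force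
      qed
    qed
    then show "\<exists>z\<in>borel_measurable M. (\<forall>\<omega>\<in>space M. 0 \<le> z \<omega> \<and> z \<omega> \<le> 1) \<and>
        (\<forall>(g, c)\<in>J. (\<integral>\<omega>. z \<omega> * g \<omega> \<partial>M) \<le> c)"
      using z(1) unfolding W_def by blast
  qed
  then obtain z where z: "z \<in> borel_measurable M" "\<forall>\<omega>\<in>space M. 0 \<le> z \<omega> \<and> z \<omega> \<le> 1"
    and H: "\<forall>(g, c)\<in>H. (\<integral>\<omega>. z \<omega> * g \<omega> \<partial>M) \<le> c" by blast
  have "1 - \<eta> \<le> expectation z" using H unfolding H_def by auto
  moreover have "(\<integral>\<omega>. z \<omega> * (w \<omega> * x \<omega>) \<partial>M) \<le> l + 1" if "x \<in> C" for x
    using H that unfolding H_def G_def by auto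
  ultimately show ?thesis using z by blast
qed

section \<open>The elementary integral\<close>

lemma pred_simple_zero: "pred_simple A (\<lambda>z. 0)"
  unfolding pred_simple_def by (intro exI[of _ "0::nat"]) simp

lemma pred_simple_scale:
  assumes "pred_simple A h" shows "pred_simple A (\<lambda>z. c * h z)"
proof -
  obtain N a S where *: "\<forall>i<N::nat. S i \<in> pred_algebra A" "h = (\<lambda>z. \<Sum>i<N. a i * indicator (S i) z)"
    using assms unfolding pred_simple_def by blast
  then have "(\<lambda>z. c * h z) = (\<lambda>z. \<Sum>i<N. (c * a i) * indicator (S i) z)"
    by (simp only: sum_distrib_left mult.assoc)
  with *(1) show ?thesis unfolding pred_simple_def
    by (intro exI[of _ N] exI[of _ "\<lambda>i. c * a i"] exI[of _ S] conjI)
qed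

lemma pred_simple_add:
  assumes "pred_simple A h" "pred_simple A k" shows "pred_simple A (\<lambda>z. h z + k z)"
proof -
  obtain N a S where h: "\<forall>i<N::nat. S i \<in> pred_algebra A" "h = (\<lambda>z. \<Sum>i<N. a i * indicator (S i) z)"
    using assms(1) unfolding pred_simple_def by blast
  obtain M b T where k: "\<forall>i<M::nat. T i \<in> pred_algebra A" "k = (\<lambda>z. \<Sum>i<M. b i * indicator (T i) z)"
    using assms(2) unfolding pred_simple_def by blast
  define c where "c i = (if i < N then a i else b (i - N))" for i
  define R where "R i = (if i < N then S i else T (i - N))" for i
  have "(\<Sum>i<N + M. c i * indicator (R i) z) = h z + k z" for z
  proof -
    have "(\<Sum>i<N + M. c i * indicator (R i) z) =
        (\<Sum>i<N. c i * indicator (R i) z) + (\<Sum>i<M. c (i + N) * indicator (R (i + N)) z)"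
      by (induction M) (auto simp: add.commute add.assoc)
    then show ?thesis unfolding h(2) k(2) c_def R_def by simp
  qed
  moreover have "\<forall>i<N + M. R i \<in> pred_algebra A" using h(1) k(1) unfolding R_def by auto
  ultimately show ?thesis unfolding pred_simple_def by (metis (no_types, lifting) ext)
qed

lemma pred_simple_sum:
  assumes "finite I" "\<And>i. i \<in> I \<Longrightarrow> pred_simple A (h i)"
  shows "pred_simple A (\<lambda>z. \<Sum>i\<in>I. h i z)"
  using assms by (induction rule: finite_induct) (auto intro: pred_simple_zero pred_simple_add)

lemma pred_simple_rectangle:
  assumes "{} \<in> A 0" "t < \<infinity>" "u < \<infinity>" "F \<in> A t"
  shows "pred_simple A (indicator (F \<times> {t<..u}))"
proof -
  have "F \<times> {t<..u} \<in> pred_algebra A"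
    unfolding pred_algebra_def using assms
    by (intro CollectI exI[of _ "{}"] exI[of _ "1::nat"] exI[of _ "\<lambda>_. F"] exI[of _ "\<lambda>_. t"]
        exI[of _ "\<lambda>_. u"]) (auto simp: disjoint_family_on_def)
  then show ?thesis unfolding pred_simple_def
    by (intro exI[of _ "1::nat"] exI[of _ "\<lambda>_. 1"] exI[of _ "\<lambda>_. F \<times> {t<..u}"]) auto
qed

text \<open>
  Passing from the definite description to the graph makes linearity available through its rules.
\<close>
lemma gains_iff:
  "x \<in> gains A f \<longleftrightarrow> (\<exists>h. pred_simple A h \<and> (\<forall>z. \<bar>h z\<bar> \<le> 1) \<and> has_elem_integral A f h x)"
proof -
  have "x = elem_integral A f h \<longleftrightarrow> has_elem_integral A f h x" if "pred_simple A h" for h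
    using pred_simple_has_elem_integral[OF that] elem_integral_eq by metis
  then show ?thesis unfolding gains_def by blast
qed

lemma gains_convex:
  assumes "x \<in> gains A f" "y \<in> gains A f" "0 \<le> u" "u \<le> 1"
  shows "(\<lambda>\<omega>. (1 - u) * x \<omega> + u * y \<omega>) \<in> gains A f"
proof -
  obtain h k where h: "pred_simple A h" "\<And>z. \<bar>h z\<bar> \<le> 1" "has_elem_integral A f h x"
    and k: "pred_simple A k" "\<And>z. \<bar>k z\<bar> \<le> 1" "has_elem_integral A f k y"
    using assms unfolding gains_iff by blast
  have "\<bar>(1 - u) * h z + u * k z\<bar> \<le> 1" for z
  proof -
    have "\<bar>(1 - u) * h z + u * k z\<bar> \<le> \<bar>(1 - u) * h z\<bar> + \<bar>u * k z\<bar>" by (rule abs_triangle_ineq)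
    also have "\<dots> \<le> (1 - u) * 1 + u * 1" unfolding abs_mult
      using h(2) k(2) assms by (intro add_mono mult_mono) auto
    finally show ?thesis by simp
  qed
  moreover have "has_elem_integral A f (\<lambda>z. (1 - u) * h z + u * k z) (\<lambda>\<omega>. (1 - u) * x \<omega> + u * y \<omega>)"
    using h k by (intro has_elem_integral.intros)
  moreover have "pred_simple A (\<lambda>z. (1 - u) * h z + u * k z)"
    using h k by (intro pred_simple_add pred_simple_scale)
  ultimately show ?thesis unfolding gains_iff by blast
qed

text \<open>
  The function \<open>1 / (1 + f*)\<close>. The case distinction is needed because \<open>enn2real\<close> sends
  \<open>\<infinity>\<close> to \<open>0\<close>, where the weight should vanish.
\<close>
definition weight :: "(ennreal \<Rightarrow> 'a \<Rightarrow> real) \<Rightarrow> 'a \<Rightarrow> real" where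
  "weight f \<omega> = (if maximal f \<omega> = \<infinity> then 0 else 1 / (1 + enn2real (maximal f \<omega>)))"

lemma weight_bounds: "0 \<le> weight f \<omega> \<and> weight f \<omega> \<le> 1"
  unfolding weight_def by (auto simp: divide_le_eq_1 add_pos_nonneg)

lemma weight_mult_process_bounded:
  assumes "t < \<infinity>" shows "weight f \<omega> * \<bar>f t \<omega>\<bar> \<le> 1"
proof (cases "maximal f \<omega> = \<infinity>")
  case False
  have "ennreal \<bar>f t \<omega>\<bar> \<le> maximal f \<omega>" unfolding maximal_def by (rule SUP_upper) (use assms in auto)
  then have "\<bar>f t \<omega>\<bar> \<le> enn2real (maximal f \<omega>)"
    using False by (metis abs_ge_zero enn2real_ennreal enn2real_mono infinity_ennreal_def top.not_eq_extremum)
  then show ?thesis using False unfolding weight_def by (simp add: field_simps)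
qed (simp add: weight_def)

lemma weight_mult_integral_bounded:
  assumes "has_elem_integral A f h x"
  shows "\<exists>B. \<forall>\<omega>. \<bar>weight f \<omega> * x \<omega>\<bar> \<le> B"
  using assms
proof induction
  case (rect t u F)
  have "\<bar>weight f \<omega> * (indicator F \<omega> * (f u \<omega> - f t \<omega>))\<bar> \<le> 2" for \<omega>
  proof -
    have "weight f \<omega> * \<bar>f u \<omega> - f t \<omega>\<bar> \<le> weight f \<omega> * (\<bar>f u \<omega>\<bar> + \<bar>f t \<omega>\<bar>)"
      using weight_bounds[of f \<omega>] by (intro mult_left_mono abs_triangle_ineq4) auto
    also have "\<dots> \<le> 1 + 1" unfolding distrib_left
      using rect by (intro add_mono weight_mult_process_bounded) auto
    finally show ?thesis using weight_bounds[of f \<omega>] by (auto simp: indicator_def abs_mult)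
  qed
  then show ?case by blast
next
  case (add h x k y)
  then obtain B C where "\<And>\<omega>. \<bar>weight f \<omega> * x \<omega>\<bar> \<le> B" "\<And>\<omega>. \<bar>weight f \<omega> * y \<omega>\<bar> \<le> C" by blast
  then have "\<bar>weight f \<omega> * (x \<omega> + y \<omega>)\<bar> \<le> B + C" for \<omega>
    unfolding distrib_left using abs_triangle_ineq add_mono order_trans by meson
  then show ?case by blast
next
  case (scale h x c)
  then obtain B where B: "\<And>\<omega>. \<bar>weight f \<omega> * x \<omega>\<bar> \<le> B" by blast
  have "\<bar>weight f \<omega> * (c * x \<omega>)\<bar> \<le> \<bar>c\<bar> * B" for \<omega>
    using mult_left_mono[OF B[of \<omega>], of "\<bar>c\<bar>"] by (simp add: abs_mult ac_simps)
  then show ?case by blast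
qed auto

locale adapted_process =
  fixes \<Omega> :: "'a set" and A :: "ennreal \<Rightarrow> 'a set set" and f :: "ennreal \<Rightarrow> 'a \<Rightarrow> real"
  assumes algebras: "\<And>t. t < \<infinity> \<Longrightarrow> algebra \<Omega> (A t)"
    and increasing: "\<And>s t. s \<le> t \<Longrightarrow> t < \<infinity> \<Longrightarrow> A s \<subseteq> A t"
    and f_adapted: "adapted (filt \<Omega> A) f"
    and maximal_measurable: "maximal f \<in> borel_measurable (filt \<Omega> A \<infinity>)"
begin

abbreviation \<F> :: "ennreal \<Rightarrow> 'a measure" where "\<F> \<equiv> filt \<Omega> A"

lemma A_subset: "t < \<infinity> \<Longrightarrow> A t \<subseteq> Pow \<Omega>"
  using algebras by (simp add: algebra_iff_Un)

lemma space_filt[simp]: "space (\<F> t) = \<Omega>"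
  unfolding filt_def by (simp add: space_measure_of_conv)

lemma sets_filt: "t < \<infinity> \<Longrightarrow> sets (\<F> t) = sigma_sets \<Omega> (A t)"
  unfolding filt_def using A_subset[of t] by (auto simp: sets_measure_of)

lemma sets_filt_infinity: "sets (\<F> \<infinity>) = sigma_sets \<Omega> (\<Union>s\<in>{..<\<infinity>}. A s)"
proof -
  have "(\<Union>s\<in>{..<\<infinity>}. A s) \<subseteq> Pow \<Omega>" by (rule UN_least) (use A_subset in simp)
  then show ?thesis unfolding filt_def by (simp add: sets_measure_of)
qed

lemma sets_filt_mono: "s \<le> t \<Longrightarrow> sets (\<F> s) \<subseteq> sets (\<F> t)"
proof (cases "t < \<infinity>")
  case True
  assume "s \<le> t"
  then have "s < \<infinity>" using True by (rule order_le_less_trans)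
  then show ?thesis using True increasing[OF \<open>s \<le> t\<close>] by (simp only: sets_filt sigma_sets_mono')
next
  case False
  then have t: "t = \<infinity>" by (metis infinity_ennreal_def top.not_eq_extremum)
  show ?thesis
  proof (cases "s < \<infinity>")
    case True
    then show ?thesis unfolding t sets_filt_infinity sets_filt[OF True]
      by (intro sigma_sets_mono') auto
  next
    case False
    then have "s = \<infinity>" by (metis infinity_ennreal_def top.not_eq_extremum)
    then show ?thesis using t by simp
  qed
qed

lemma A_measurable: "t < \<infinity> \<Longrightarrow> B \<in> A t \<Longrightarrow> B \<in> sets (\<F> t)"
  using sets_filt by auto

lemma measurable_filt_mono: "s \<le> t \<Longrightarrow> g \<in> borel_measurable (\<F> s) \<Longrightarrow> g \<in> borel_measurable (\<F> t)"
  using sets_filt_mono by (auto simp: measurable_def)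

lemma f_measurable: "f t \<in> borel_measurable (\<F> t)"
  using f_adapted unfolding adapted_def by auto

lemma weight_measurable: "weight f \<in> borel_measurable (\<F> \<infinity>)"
  unfolding weight_def using maximal_measurable by measurable

lemma elem_integral_measurable:
  assumes "has_elem_integral A f h x"
  shows "x \<in> borel_measurable (\<F> \<infinity>)"
  using assms
proof induction
  case (rect t u F)
  then have "t < \<infinity>" by (meson order_le_less_trans)
  have "F \<in> sets (\<F> \<infinity>)" using A_measurable[OF \<open>t < \<infinity>\<close>] sets_filt_mono[of t \<infinity>] rect by auto
  moreover have "f t \<in> borel_measurable (\<F> \<infinity>)" "f u \<in> borel_measurable (\<F> \<infinity>)"
    using measurable_filt_mono[OF _ f_measurable] by auto
  ultimately show ?case by auto
qed auto

text \<open>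
  Holding \<open>1\<close> on \<open>B n\<close> and \<open>-1\<close> off it during the \<open>n\<close>-th period is an integrand bounded by one,
  since the periods are disjoint.
\<close>
lemma sign_strategy_gain:
  fixes t :: "nat \<Rightarrow> ennreal"
  assumes mono: "mono_on {1..N} t" and fin: "\<And>n. n \<in> {1..N} \<Longrightarrow> t n < \<infinity>"
    and B: "\<And>n. n \<in> {1..<N} \<Longrightarrow> B n \<in> A (t n)"
  shows "(\<lambda>\<omega>. \<Sum>n=1..<N. (2 * indicator (B n) \<omega> - indicator \<Omega> \<omega>) * (f (t (Suc n)) \<omega> - f (t n) \<omega>))
    \<in> gains A f"
proof -
  define R where "R n = {t n<..t (Suc n)}" for n
  define h :: "nat \<Rightarrow> 'a \<times> ennreal \<Rightarrow> real"
    where "h n z = 2 * indicator (B n \<times> R n) z + (- 1) * indicator (\<Omega> \<times> R n) z" for n z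
  have step: "t n \<le> t (Suc n)" "t n < \<infinity>" "t (Suc n) < \<infinity>" "B n \<in> A (t n)" "\<Omega> \<in> A (t n)"
    if "n \<in> {1..<N}" for n
    using that mono_onD[OF mono, of n "Suc n"] fin B algebra.top[OF algebras] by auto
  have "{} \<in> A 0" using algebras[of 0] by (simp add: algebra_iff_Un)
  then have simple: "pred_simple A (\<lambda>z. \<Sum>n=1..<N. h n z)"
    unfolding h_def R_def using step
    by (intro pred_simple_sum pred_simple_add pred_simple_scale pred_simple_rectangle) auto
  have integral: "has_elem_integral A f (h n)
      (\<lambda>\<omega>. (2 * indicator (B n) \<omega> - indicator \<Omega> \<omega>) * (f (t (Suc n)) \<omega> - f (t n) \<omega>))"
    if n: "n \<in> {1..<N}" for n
  proof -
    have "has_elem_integral A f (\<lambda>z. 2 * indicator (B n \<times> R n) z + (- 1) * indicator (\<Omega> \<times> R n) z)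
      (\<lambda>\<omega>. 2 * (indicator (B n) \<omega> * (f (t (Suc n)) \<omega> - f (t n) \<omega>)) +
         (- 1) * (indicator \<Omega> \<omega> * (f (t (Suc n)) \<omega> - f (t n) \<omega>)))"
      unfolding R_def using step[OF n]
      by (intro has_elem_integral.add has_elem_integral.scale has_elem_integral.rect)
    then show ?thesis unfolding h_def by (simp add: algebra_simps)
  qed
  have disj: "disjoint_family_on R {1..<N}"
  proof -
    have "R m \<inter> R n = {}" if "m \<in> {1..<N}" "n \<in> {1..<N}" "m < n" for m n
    proof -
      have "t (Suc m) \<le> t n" using mono_onD[OF mono, of "Suc m" n] that by auto
      then show ?thesis unfolding R_def by auto
    qed
    then show ?thesis unfolding disjoint_family_on_def by (metis inf_commute linorder_neqE_nat)
  qed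
  have "\<bar>\<Sum>n=1..<N. h n z\<bar> \<le> 1" for z
  proof -
    have "\<bar>\<Sum>n=1..<N. h n z\<bar> \<le> (\<Sum>n=1..<N. \<bar>h n z\<bar>)" by (rule sum_abs)
    also have "\<dots> \<le> (\<Sum>n=1..<N. indicator (R n) (snd z))"
    proof (rule sum_mono)
      fix n assume "n \<in> {1..<N}"
      then have "B n \<subseteq> \<Omega>" using step A_subset by blast
      then show "\<bar>h n z\<bar> \<le> indicator (R n) (snd z)" unfolding h_def
        by (cases z) (auto simp: indicator_def)
    qed
    also have "\<dots> = indicator (\<Union>n\<in>{1..<N}. R n) (snd z)"
      by (rule indicator_UN_disjoint[symmetric]) (use disj in auto)
    also have "\<dots> \<le> 1" by (simp add: indicator_def)
    finally show ?thesis .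
  qed
  moreover have "has_elem_integral A f (\<lambda>z. \<Sum>n=1..<N. h n z)
    (\<lambda>\<omega>. \<Sum>n=1..<N. (2 * indicator (B n) \<omega> - indicator \<Omega> \<omega>) * (f (t (Suc n)) \<omega> - f (t n) \<omega>))"
    using integral by (intro has_elem_integral_sum) auto
  ultimately show ?thesis unfolding gains_iff using simple by blast
qed

end

context adapted_process
begin

section \<open>The supermartingale generated by a density\<close>

text \<open>
  Conditional expectations are only almost surely nonnegative, whence the truncation. At \<open>\<infinity>\<close>
  the density is divided by \<open>1 + |f \<infinity>|\<close> because nothing else makes the product with \<open>f \<infinity>\<close> integrable.
\<close>
definition dual_supermartingale :: "'a measure \<Rightarrow> ('a \<Rightarrow> real) \<Rightarrow> ennreal \<Rightarrow> 'a \<Rightarrow> real" where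
  "dual_supermartingale Q Z t = (if t = \<infinity> then (\<lambda>\<omega>. Z \<omega> / (1 + \<bar>f \<infinity> \<omega>\<bar>))
     else (\<lambda>\<omega>. max 0 (real_cond_exp Q (\<F> t) Z \<omega>)))"

context
  fixes Q :: "'a measure"
  assumes Q: "Q \<in> probabilities (\<F> \<infinity>)"
begin

lemma prob_space_Q: "prob_space Q" and space_Q: "space Q = \<Omega>" and sets_Q: "sets Q = sets (\<F> \<infinity>)"
  using Q unfolding probabilities_def by auto

lemma subalgebra_Q: "subalgebra Q (\<F> t)"
  unfolding subalgebra_def using space_Q sets_Q sets_filt_mono[of t \<infinity>] by auto

lemma sigma_finite_subalgebra_Q: "sigma_finite_subalgebra Q (\<F> t)"
  using prob_space_Q subalgebra_Q
  by (intro finite_measure_subalgebra_is_sigma_finite finite_measure_subalgebra.intro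
      finite_measure_subalgebra_axioms.intro prob_space.finite_measure)

lemma filt_measurable_Q: "g \<in> borel_measurable (\<F> t) \<Longrightarrow> g \<in> borel_measurable Q"
  using measurable_from_subalg[OF subalgebra_Q] by blast

lemma integrable_bounded_Q:
  fixes g :: "'a \<Rightarrow> real"
  assumes "g \<in> borel_measurable Q" "\<And>\<omega>. \<omega> \<in> \<Omega> \<Longrightarrow> \<bar>g \<omega>\<bar> \<le> B"
  shows "integrable Q g"
proof -
  interpret prob_space Q by (rule prob_space_Q)
  show ?thesis by (rule integrable_const_bound[where B=B]) (use assms space_Q in \<open>auto intro!: AE_I2\<close>)
qed

context
  fixes Z :: "'a \<Rightarrow> real"
  assumes Z_meas: "Z \<in> borel_measurable (\<F> \<infinity>)"
    and Z: "\<And>\<omega>. \<omega> \<in> \<Omega> \<Longrightarrow> 0 \<le> Z \<omega> \<and> Z \<omega> \<le> 1"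
    and Zf: "\<And>t \<omega>. t < \<infinity> \<Longrightarrow> \<omega> \<in> \<Omega> \<Longrightarrow> \<bar>f t \<omega> * Z \<omega>\<bar> \<le> 1"
begin

private abbreviation "X \<equiv> dual_supermartingale Q Z"

lemma Z_integrable: "integrable Q Z"
  using Z by (intro integrable_bounded_Q[where B=1] filt_measurable_Q[OF Z_meas]) auto

lemma fZ_integrable: "t < \<infinity> \<Longrightarrow> integrable Q (\<lambda>\<omega>. f t \<omega> * Z \<omega>)"
  using Zf filt_measurable_Q[OF Z_meas] filt_measurable_Q[OF f_measurable]
  by (intro integrable_bounded_Q[where B=1]) auto

lemma dual_adapted: "X t \<in> borel_measurable (\<F> t)"
proof (cases "t = \<infinity>")
  case True
  have [measurable]: "f \<infinity> \<in> borel_measurable (\<F> \<infinity>)" "Z \<in> borel_measurable (\<F> \<infinity>)"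
    using f_measurable Z_meas by auto
  have "(\<lambda>\<omega>. Z \<omega> / (1 + \<bar>f \<infinity> \<omega>\<bar>)) \<in> borel_measurable (\<F> \<infinity>)" by measurable
  then show ?thesis unfolding dual_supermartingale_def True by simp
qed (simp add: dual_supermartingale_def)

lemma dual_nonneg: "\<omega> \<in> \<Omega> \<Longrightarrow> 0 \<le> X t \<omega>"
  unfolding dual_supermartingale_def using Z by auto

lemma dual_infinity_le: "\<omega> \<in> \<Omega> \<Longrightarrow> X \<infinity> \<omega> \<le> Z \<omega>"
  using Z[of \<omega>] unfolding dual_supermartingale_def by (simp add: divide_le_eq mult_left_le mult_le_cancel_left1)

lemma dual_cond_exp:
  assumes "t < \<infinity>"
  shows "AE \<omega> in Q. X t \<omega> = real_cond_exp Q (\<F> t) Z \<omega>"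
proof -
  interpret sigma_finite_subalgebra Q "\<F> t" by (rule sigma_finite_subalgebra_Q)
  have "AE \<omega> in Q. 0 \<le> real_cond_exp Q (\<F> t) Z \<omega>"
    using Z space_Q filt_measurable_Q[OF Z_meas] by (intro real_cond_exp_pos AE_I2) auto
  then show ?thesis unfolding dual_supermartingale_def using assms by auto
qed

lemma dual_mult_cond_exp:
  assumes "t < \<infinity>"
  shows "AE \<omega> in Q. X t \<omega> * f t \<omega> = real_cond_exp Q (\<F> t) (\<lambda>\<omega>. f t \<omega> * Z \<omega>) \<omega>"
proof -
  interpret sigma_finite_subalgebra Q "\<F> t" by (rule sigma_finite_subalgebra_Q)
  have "AE \<omega> in Q. real_cond_exp Q (\<F> t) (\<lambda>\<omega>. f t \<omega> * Z \<omega>) \<omega> = f t \<omega> * real_cond_exp Q (\<F> t) Z \<omega>"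
    by (rule real_cond_exp_mult[OF f_measurable filt_measurable_Q[OF Z_meas] fZ_integrable[OF assms]])
  with dual_cond_exp[OF assms] show ?thesis by eventually_elim simp
qed

lemma dual_integrable: "integrable Q (X t)"
proof (cases "t = \<infinity>")
  case True
  have "\<bar>X \<infinity> \<omega>\<bar> \<le> 1" if "\<omega> \<in> \<Omega>" for \<omega>
    using dual_nonneg[OF that, of \<infinity>] dual_infinity_le[OF that] Z[OF that] by simp
  then show ?thesis unfolding True
    by (intro integrable_bounded_Q[where B=1] filt_measurable_Q[OF dual_adapted])
next
  case False
  then have t: "t < \<infinity>" by (metis infinity_ennreal_def top.not_eq_extremum)
  interpret sigma_finite_subalgebra Q "\<F> t" by (rule sigma_finite_subalgebra_Q)
  have "integrable Q (real_cond_exp Q (\<F> t) Z)" using real_cond_exp_int(1)[OF Z_integrable] .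
  then show ?thesis
    by (rule integrable_cong_AE_imp) (use dual_cond_exp[OF t] filt_measurable_Q[OF dual_adapted] in auto)
qed

lemma dual_mult_integrable: "integrable Q (\<lambda>\<omega>. X t \<omega> * f t \<omega>)"
proof (cases "t = \<infinity>")
  case True
  have "\<bar>X \<infinity> \<omega> * f \<infinity> \<omega>\<bar> \<le> 1" if "\<omega> \<in> \<Omega>" for \<omega>
  proof -
    have "Z \<omega> * \<bar>f \<infinity> \<omega>\<bar> \<le> 1 * \<bar>f \<infinity> \<omega>\<bar>" using Z[OF that] by (intro mult_right_mono) auto
    then show ?thesis using Z[OF that] unfolding dual_supermartingale_def
      by (simp add: abs_mult divide_le_eq)
  qed
  then show ?thesis unfolding True
    using filt_measurable_Q[OF dual_adapted[of \<infinity>]] filt_measurable_Q[OF f_measurable[of \<infinity>]]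
    by (intro integrable_bounded_Q[where B=1]) auto
next
  case False
  then have t: "t < \<infinity>" by (metis infinity_ennreal_def top.not_eq_extremum)
  interpret sigma_finite_subalgebra Q "\<F> t" by (rule sigma_finite_subalgebra_Q)
  have "integrable Q (real_cond_exp Q (\<F> t) (\<lambda>\<omega>. f t \<omega> * Z \<omega>))"
    using real_cond_exp_int(1)[OF fZ_integrable[OF t]] .
  then show ?thesis
    by (rule integrable_cong_AE_imp)
      (use dual_mult_cond_exp[OF t] filt_measurable_Q[OF dual_adapted] filt_measurable_Q[OF f_measurable] in auto)
qed

lemma dual_is_supermartingale: "supermartingale Q \<F> X"
  unfolding supermartingale_def adapted_def
proof (intro conjI allI impI)
  fix s t :: ennreal assume "s \<le> t"
  interpret sigma_finite_subalgebra Q "\<F> s" by (rule sigma_finite_subalgebra_Q)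
  have sub: "subalgebra (\<F> t) (\<F> s)"
    unfolding subalgebra_def using sets_filt_mono[OF \<open>s \<le> t\<close>] by auto
  consider "s = \<infinity>" "t = \<infinity>" | "s < \<infinity>" "t = \<infinity>" | "s < \<infinity>" "t < \<infinity>"
    using \<open>s \<le> t\<close> by (metis infinity_ennreal_def top.extremum_unique top.not_eq_extremum)
  then show "AE \<omega> in Q. real_cond_exp Q (\<F> s) (X t) \<omega> \<le> X s \<omega>"
  proof cases
    case 1
    have "AE \<omega> in Q. real_cond_exp Q (\<F> s) (X t) \<omega> = X t \<omega>"
      by (rule real_cond_exp_F_meas) (use 1 dual_integrable dual_adapted in auto)
    then show ?thesis using 1 by auto
  next
    case 2
    have "AE \<omega> in Q. real_cond_exp Q (\<F> s) (X t) \<omega> \<le> real_cond_exp Q (\<F> s) Z \<omega>"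
      by (rule real_cond_exp_mono)
        (use 2 dual_integrable Z_integrable dual_infinity_le space_Q in \<open>auto intro!: AE_I2\<close>)
    with dual_cond_exp[OF 2(1)] show ?thesis by eventually_elim simp
  next
    case 3
    have "AE \<omega> in Q. real_cond_exp Q (\<F> s) (X t) \<omega> =
        real_cond_exp Q (\<F> s) (real_cond_exp Q (\<F> t) Z) \<omega>"
      by (rule real_cond_exp_cong[OF dual_cond_exp[OF 3(2)]]) (use filt_measurable_Q[OF dual_adapted] in auto)
    moreover have "AE \<omega> in Q. real_cond_exp Q (\<F> s) (real_cond_exp Q (\<F> t) Z) \<omega> = real_cond_exp Q (\<F> s) Z \<omega>"
      by (rule real_cond_exp_nested_subalg[OF subalgebra_Q sub Z_integrable])
    ultimately show ?thesis using dual_cond_exp[OF 3(1)] by eventually_elim simp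
  qed
qed (use dual_adapted dual_integrable in auto)

text \<open>
  On the left stands the mean of the modulus of \<open>E (Z (f u - f t) | \<F> t)\<close>, which is the mean of
  \<open>Z (f u - f t)\<close> times the sign of that conditional expectation. The set \<open>B\<close> replaces the set
  where the sign is positive; since \<open>Z (f u - f t)\<close> is bounded by two and the signs differ by two,
  the error is at most four times the measure of the symmetric difference.
\<close>
lemma conditional_increment_bound:
  assumes "t \<le> u" "u < \<infinity>" "0 < \<epsilon>"
  shows "\<exists>B\<in>A t. (\<integral>\<omega>. \<bar>real_cond_exp Q (\<F> t) (\<lambda>\<omega>. X u \<omega> * f u \<omega>) \<omega> - X t \<omega> * f t \<omega>\<bar> \<partial>Q) \<le>
     (\<integral>\<omega>. Z \<omega> * ((2 * indicator B \<omega> - indicator \<Omega> \<omega>) * (f u \<omega> - f t \<omega>)) \<partial>Q) + \<epsilon>"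
proof -
  have t: "t < \<infinity>" using assms by (meson order_le_less_trans)
  interpret Q: prob_space Q by (rule prob_space_Q)
  interpret sigma_finite_subalgebra Q "\<F> t" by (rule sigma_finite_subalgebra_Q)
  have sub: "subalgebra (\<F> u) (\<F> t)"
    unfolding subalgebra_def using sets_filt_mono[OF \<open>t \<le> u\<close>] by auto
  define D where "D \<omega> = real_cond_exp Q (\<F> t) (\<lambda>\<omega>. X u \<omega> * f u \<omega>) \<omega> - X t \<omega> * f t \<omega>" for \<omega>
  define g where "g \<omega> = f u \<omega> * Z \<omega> - f t \<omega> * Z \<omega>" for \<omega>
  have [measurable]: "f t \<in> borel_measurable Q" "f u \<in> borel_measurable Q" "Z \<in> borel_measurable Q"
    "X u \<in> borel_measurable Q" "f t \<in> borel_measurable (\<F> t)" "X t \<in> borel_measurable (\<F> t)"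
    using filt_measurable_Q[OF f_measurable] filt_measurable_Q[OF Z_meas]
      filt_measurable_Q[OF dual_adapted] f_measurable dual_adapted by auto
  have D_meas[measurable]: "D \<in> borel_measurable (\<F> t)" unfolding D_def by measurable
  have D_measQ[measurable]: "D \<in> borel_measurable Q" by (rule filt_measurable_Q[OF D_meas])
  have g_meas[measurable]: "g \<in> borel_measurable Q" unfolding g_def by measurable
  have g_bound: "\<bar>g \<omega>\<bar> \<le> 2" if "\<omega> \<in> \<Omega>" for \<omega>
    using Zf[OF t that] Zf[OF \<open>u < \<infinity>\<close> that] unfolding g_def by linarith
  have "AE \<omega> in Q. real_cond_exp Q (\<F> t) (\<lambda>\<omega>. X u \<omega> * f u \<omega>) \<omega> =
      real_cond_exp Q (\<F> t) (real_cond_exp Q (\<F> u) (\<lambda>\<omega>. f u \<omega> * Z \<omega>)) \<omega>"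
    by (rule real_cond_exp_cong[OF dual_mult_cond_exp[OF \<open>u < \<infinity>\<close>]]) auto
  moreover have "AE \<omega> in Q. real_cond_exp Q (\<F> t) (real_cond_exp Q (\<F> u) (\<lambda>\<omega>. f u \<omega> * Z \<omega>)) \<omega> =
      real_cond_exp Q (\<F> t) (\<lambda>\<omega>. f u \<omega> * Z \<omega>) \<omega>"
    by (rule real_cond_exp_nested_subalg[OF subalgebra_Q sub fZ_integrable[OF \<open>u < \<infinity>\<close>]])
  moreover have "AE \<omega> in Q. real_cond_exp Q (\<F> t) g \<omega> = real_cond_exp Q (\<F> t) (\<lambda>\<omega>. f u \<omega> * Z \<omega>) \<omega> -
      real_cond_exp Q (\<F> t) (\<lambda>\<omega>. f t \<omega> * Z \<omega>) \<omega>"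
    unfolding g_def by (rule real_cond_exp_diff[OF fZ_integrable[OF \<open>u < \<infinity>\<close>] fZ_integrable[OF t]])
  ultimately have D_g: "AE \<omega> in Q. D \<omega> = real_cond_exp Q (\<F> t) g \<omega>"
    using dual_mult_cond_exp[OF t] unfolding D_def by eventually_elim simp
  define B where "B = {\<omega>\<in>\<Omega>. 0 \<le> D \<omega>}"
  have B_meas[measurable]: "B \<in> sets (\<F> t)"
  proof -
    have "{\<omega>\<in>space (\<F> t). 0 \<le> D \<omega>} \<in> sets (\<F> t)" by measurable
    then show ?thesis unfolding B_def by simp
  qed
  have B_measQ[measurable]: "B \<in> sets Q" using B_meas subalgebra_Q[of t] unfolding subalgebra_def by blast
  obtain C where C: "C \<in> A t" "Q.prob (sym_diff B C) < \<epsilon> / 4"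
  proof -
    have "\<exists>C\<in>A t. Q.prob (sym_diff B C) < \<epsilon> / 4"
    proof (rule Q.sigma_sets_approximation)
      show "algebra (space Q) (A t)" using algebras[OF t] space_Q by simp
      show "A t \<subseteq> sets Q" using A_measurable[OF t] subalgebra_Q[of t] unfolding subalgebra_def by auto
      show "B \<in> sigma_sets (space Q) (A t)" using B_meas sets_filt[OF t] space_Q by simp
    qed (use \<open>0 < \<epsilon>\<close> in simp)
    then show ?thesis using that by blast
  qed
  have C_measQ[measurable]: "C \<in> sets Q"
    using A_measurable[OF t C(1)] subalgebra_Q[of t] unfolding subalgebra_def by auto
  have C_sub: "C \<subseteq> \<Omega>" using A_subset[OF t] C(1) by auto
  define s where "s E \<omega> = 2 * indicator E \<omega> - (1::real)" for E :: "'a set" and \<omega>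
  have s_bound: "\<bar>s E \<omega>\<bar> \<le> 1" for E \<omega> unfolding s_def by (simp add: indicator_def)
  have s_meas[measurable]: "s B \<in> borel_measurable (\<F> t)" "s B \<in> borel_measurable Q" "s C \<in> borel_measurable Q"
    unfolding s_def by measurable
  have sg: "integrable Q (\<lambda>\<omega>. s E \<omega> * g \<omega>)" if [measurable]: "s E \<in> borel_measurable Q" for E
  proof (rule integrable_bounded_Q[where B=2])
    fix \<omega> assume "\<omega> \<in> \<Omega>"
    have "\<bar>s E \<omega>\<bar> * \<bar>g \<omega>\<bar> \<le> 1 * 2" using s_bound g_bound[OF \<open>\<omega> \<in> \<Omega>\<close>] by (intro mult_mono) auto
    then show "\<bar>s E \<omega> * g \<omega>\<bar> \<le> 2" by (simp add: abs_mult)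
  qed measurable
  have diff_int: "integrable Q (\<lambda>\<omega>. 4 * indicator (sym_diff B C) \<omega> :: real)"
    by (intro integrable_bounded_Q[where B=4]) (auto simp: indicator_def)
  have "(\<integral>\<omega>. \<bar>D \<omega>\<bar> \<partial>Q) = (\<integral>\<omega>. s B \<omega> * real_cond_exp Q (\<F> t) g \<omega> \<partial>Q)"
  proof (rule integral_cong_AE)
    show "AE \<omega> in Q. \<bar>D \<omega>\<bar> = s B \<omega> * real_cond_exp Q (\<F> t) g \<omega>"
      using D_g AE_space
    proof eventually_elim
      fix \<omega> assume "D \<omega> = real_cond_exp Q (\<F> t) g \<omega>" "\<omega> \<in> space Q"
      then show "\<bar>D \<omega>\<bar> = s B \<omega> * real_cond_exp Q (\<F> t) g \<omega>"
        using space_Q unfolding s_def B_def by (auto simp: indicator_def)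
    qed
  qed measurable
  also have "\<dots> = (\<integral>\<omega>. s B \<omega> * g \<omega> \<partial>Q)"
    by (rule real_cond_exp_intg(2)[OF sg s_meas(1) g_meas]) measurable
  also have "\<dots> \<le> (\<integral>\<omega>. s C \<omega> * g \<omega> + 4 * indicator (sym_diff B C) \<omega> \<partial>Q)"
  proof (rule integral_mono)
    fix \<omega> assume "\<omega> \<in> space Q"
    then have "\<bar>g \<omega>\<bar> \<le> 2" using g_bound space_Q by simp
    then show "s B \<omega> * g \<omega> \<le> s C \<omega> * g \<omega> + 4 * indicator (sym_diff B C) \<omega>"
      unfolding s_def by (auto simp: indicator_def)
  qed (use sg diff_int in auto)
  also have "\<dots> = (\<integral>\<omega>. s C \<omega> * g \<omega> \<partial>Q) + 4 * Q.prob (sym_diff B C)"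
  proof -
    have "(\<integral>\<omega>. indicator (sym_diff B C) \<omega> \<partial>Q) = Q.prob (sym_diff B C)"
      by (simp add: Int_absorb2 sets.sets_into_space)
    then show ?thesis using sg diff_int by (subst Bochner_Integration.integral_add) auto
  qed
  also have "\<dots> \<le> (\<integral>\<omega>. s C \<omega> * g \<omega> \<partial>Q) + \<epsilon>" using C(2) by simp
  also have "(\<integral>\<omega>. s C \<omega> * g \<omega> \<partial>Q) =
      (\<integral>\<omega>. Z \<omega> * ((2 * indicator C \<omega> - indicator \<Omega> \<omega>) * (f u \<omega> - f t \<omega>)) \<partial>Q)"
    by (rule Bochner_Integration.integral_cong)
      (auto simp: s_def g_def space_Q algebra_simps)
  finally show ?thesis using C(1) unfolding D_def by blast
qed

lemma dual_mult_is_quasimartingale: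
  assumes dual: "\<And>x. x \<in> gains A f \<Longrightarrow> (\<integral>\<omega>. Z \<omega> * x \<omega> \<partial>Q) \<le> c"
  shows "quasimartingale Q \<F> (\<lambda>t \<omega>. X t \<omega> * f t \<omega>)"
proof -
  define V where "V t u = (\<integral>\<omega>. \<bar>real_cond_exp Q (\<F> t) (\<lambda>\<omega>. X u \<omega> * f u \<omega>) \<omega> - X t \<omega> * f t \<omega>\<bar> \<partial>Q)"
    for t u
  have "(\<Sum>n=1..<N. V (t n) (t (Suc n))) \<le> c + 1"
    if t: "mono_on {1..N} t" "\<forall>n\<in>{1..N}. t n < \<infinity>" for N :: nat and t
  proof -
    define G where "G B n \<omega> = (2 * indicator B \<omega> - indicator \<Omega> \<omega>) * (f (t (Suc n)) \<omega> - f (t n) \<omega>)"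
      for B n \<omega>
    have step: "t n \<le> t (Suc n)" "t n < \<infinity>" "t (Suc n) < \<infinity>" if "n \<in> {1..<N}" for n
      using that mono_onD[OF t(1), of n "Suc n"] t(2) by auto
    have "\<exists>B\<in>A (t n). V (t n) (t (Suc n)) \<le> (\<integral>\<omega>. Z \<omega> * G B n \<omega> \<partial>Q) + 1 / N" if "n \<in> {1..<N}" for n
      unfolding V_def G_def using step[OF that] that by (intro conditional_increment_bound) auto
    then obtain B where B: "\<And>n. n \<in> {1..<N} \<Longrightarrow> B n \<in> A (t n)"
      "\<And>n. n \<in> {1..<N} \<Longrightarrow> V (t n) (t (Suc n)) \<le> (\<integral>\<omega>. Z \<omega> * G (B n) n \<omega> \<partial>Q) + 1 / N" by metis
    have int: "integrable Q (\<lambda>\<omega>. Z \<omega> * G (B n) n \<omega>)" if n: "n \<in> {1..<N}" for n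
    proof (rule integrable_bounded_Q[where B=2])
      have [measurable]: "B n \<in> sets Q" "\<Omega> \<in> sets Q"
        using A_measurable[OF step(2)[OF n] B(1)[OF n]] subalgebra_Q[of "t n"] sets.top[of Q] space_Q
        unfolding subalgebra_def by auto
      have [measurable]: "Z \<in> borel_measurable Q" "\<And>t. f t \<in> borel_measurable Q"
        using filt_measurable_Q[OF Z_meas] filt_measurable_Q[OF f_measurable] by auto
      show "(\<lambda>\<omega>. Z \<omega> * G (B n) n \<omega>) \<in> borel_measurable Q" unfolding G_def by measurable
      fix \<omega> assume \<omega>: "\<omega> \<in> \<Omega>"
      have "\<bar>Z \<omega> * G (B n) n \<omega>\<bar> = \<bar>f (t (Suc n)) \<omega> * Z \<omega> - f (t n) \<omega> * Z \<omega>\<bar>"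
        using \<omega> unfolding G_def by (auto simp: indicator_def algebra_simps abs_minus_commute)
      then show "\<bar>Z \<omega> * G (B n) n \<omega>\<bar> \<le> 2"
        using Zf[OF step(2)[OF n] \<omega>] Zf[OF step(3)[OF n] \<omega>] by linarith
    qed
    have "(\<Sum>n=1..<N. V (t n) (t (Suc n))) \<le> (\<Sum>n=1..<N. (\<integral>\<omega>. Z \<omega> * G (B n) n \<omega> \<partial>Q) + 1 / N)"
      by (rule sum_mono) (use B in auto)
    also have "\<dots> = (\<integral>\<omega>. Z \<omega> * (\<Sum>n=1..<N. G (B n) n \<omega>) \<partial>Q) + (\<Sum>n=1..<N. 1 / N)"
      using int by (simp add: sum.distrib sum_distrib_left Bochner_Integration.integral_sum)
    also have "\<dots> \<le> c + 1"
    proof (rule add_mono)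
      show "(\<integral>\<omega>. Z \<omega> * (\<Sum>n=1..<N. G (B n) n \<omega>) \<partial>Q) \<le> c"
        unfolding G_def using sign_strategy_gain[OF t(1) _ B(1)] t(2) by (intro dual) auto
      show "(\<Sum>n=1..<N. 1 / real N) \<le> 1" by (cases "N = 0") (auto simp: field_simps)
    qed
    finally show ?thesis .
  qed
  then have "bdd_above {(\<Sum>n=1..<N. V (t n) (t (Suc n))) | N t. mono_on {1..N} t \<and> (\<forall>n\<in>{1..N}. t n < \<infinity>)}"
    by (intro bdd_aboveI[where M = "c + 1"]) blast
  moreover have "(\<lambda>\<omega>. X t \<omega> * f t \<omega>) \<in> borel_measurable (\<F> t)" for t
    using dual_adapted[of t] f_measurable[of t] by measurable
  ultimately show ?thesis
    unfolding quasimartingale_def adapted_def V_def using dual_mult_integrable by blast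
qed

end

end

section \<open>Tails of the gains and the choice of the density\<close>

text \<open>
  A gain that is at least \<open>l\<^sub>0\<close> on some \<open>U \<in> \<U>\<close> and bounded there dominates \<open>l\<^sub>0 1\<^sub>U\<close>, which is
  excluded; so such a set has measure below \<open>\<eta>\<close>, and the bound passes to the limit as \<open>{f* < k}\<close>
  exhausts the space.
\<close>
lemma gain_tail_bound:
  assumes Q: "Q \<in> probabilities (\<F> \<infinity>)"
    and finite: "measure Q {\<omega>\<in>\<Omega>. maximal f \<omega> < \<infinity>} = 1"
    and large: "\<And>F k. F \<in> sets (\<F> \<infinity>) \<Longrightarrow> k > 0 \<Longrightarrow>
        measure Q (F \<inter> {\<omega>\<in>\<Omega>. maximal f \<omega> < of_nat k}) \<ge> \<eta> \<Longrightarrow>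
        F \<inter> {\<omega>\<in>\<Omega>. maximal f \<omega> < of_nat k} \<in> \<U>"
    and not_dominated: "\<And>U. U \<in> \<U> \<Longrightarrow>
        {(\<lambda>\<omega>. l * indicator U \<omega>) | l::real. l \<ge> l\<^sub>0} \<inter> {(\<lambda>\<omega>. x \<omega> * indicator U \<omega>) | x. x \<in> claims \<Omega> A f} = {}"
    and x: "x \<in> gains A f"
  shows "measure Q {\<omega>\<in>\<Omega>. l\<^sub>0 \<le> x \<omega>} \<le> \<eta>"
proof -
  interpret prob_space Q using Q unfolding probabilities_def by auto
  have spQ: "space Q = \<Omega>" and setsQ: "sets Q = sets (\<F> \<infinity>)" using Q unfolding probabilities_def by auto
  obtain h where h: "has_elem_integral A f h x" using x unfolding gains_iff by blast
  have x_meas[measurable]: "x \<in> borel_measurable (\<F> \<infinity>)" by (rule elem_integral_measurable[OF h])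
  note maximal_measurable[measurable]
  obtain b where b: "\<And>\<omega>. \<bar>weight f \<omega> * x \<omega>\<bar> \<le> b" using weight_mult_integral_bounded[OF h] by blast
  define E where "E = {\<omega>\<in>\<Omega>. l\<^sub>0 \<le> x \<omega>}"
  define M where "M k = {\<omega>\<in>\<Omega>. maximal f \<omega> < of_nat k}" for k :: nat
  have E: "E \<in> sets (\<F> \<infinity>)"
  proof -
    have "{\<omega>\<in>space (\<F> \<infinity>). l\<^sub>0 \<le> x \<omega>} \<in> sets (\<F> \<infinity>)" by measurable
    then show ?thesis unfolding E_def by simp
  qed
  have M: "M k \<in> sets (\<F> \<infinity>)" for k
  proof -
    have "{\<omega>\<in>space (\<F> \<infinity>). maximal f \<omega> < of_nat k} \<in> sets (\<F> \<infinity>)" by measurable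
    then show ?thesis unfolding M_def by simp
  qed
  have M_UN: "(\<Union>k. M k) = {\<omega>\<in>\<Omega>. maximal f \<omega> < \<infinity>}"
  proof -
    have "\<exists>k::nat. m < of_nat k" if "m < \<infinity>" for m :: ennreal
      using that by (simp add: ennreal_Ex_less_of_nat)
    moreover have "m < \<infinity>" if "m < of_nat k" for m :: ennreal and k :: nat
      using that by (metis infinity_ennreal_def less_trans of_nat_less_top)
    ultimately show ?thesis unfolding M_def by blast
  qed
  have small: "measure Q (E \<inter> M k) \<le> \<eta>" if "k > 0" for k
  proof (rule ccontr)
    assume "\<not> ?thesis"
    then have U: "E \<inter> M k \<in> \<U>" using large[OF E that] unfolding M_def by simp
    \<comment> \<open>The part of the gain in excess of \<open>l\<^sub>0\<close>, to be thrown away.\<close>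
    define p where "p \<omega> = (x \<omega> - l\<^sub>0) * indicator (E \<inter> M k) \<omega>" for \<omega>
    have bound: "\<bar>x \<omega>\<bar> \<le> b * (1 + real k)" if "\<omega> \<in> M k" for \<omega>
    proof -
      have lt: "maximal f \<omega> < of_nat k" using that unfolding M_def by simp
      then have fin: "maximal f \<omega> \<noteq> \<infinity>" by auto
      have "enn2real (maximal f \<omega>) \<le> real k"
        using lt by (metis enn2real_leI ennreal_of_nat_eq_real_of_nat less_imp_le of_nat_0_le_iff)
      then have "\<bar>x \<omega>\<bar> = \<bar>weight f \<omega> * x \<omega>\<bar> * (1 + enn2real (maximal f \<omega>))"
        using fin unfolding weight_def by (simp add: abs_mult add_nonneg_eq_0_iff)
      also have "\<dots> \<le> b * (1 + real k)"
        using b \<open>enn2real (maximal f \<omega>) \<le> real k\<close> by (intro mult_mono) (auto intro: order_trans[OF abs_ge_zero])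
      finally show ?thesis .
    qed
    have "p \<in> bounded_nonneg (\<F> \<infinity>)"
    proof -
      have "p \<in> borel_measurable (\<F> \<infinity>)" unfolding p_def using E M by measurable
      moreover have "0 \<le> p \<omega>" for \<omega> unfolding p_def E_def by (auto simp: indicator_def)
      moreover have "\<bar>p \<omega>\<bar> \<le> b * (1 + real k) + \<bar>l\<^sub>0\<bar>" for \<omega>
      proof (cases "\<omega> \<in> E \<inter> M k")
        case True
        then show ?thesis using bound[of \<omega>] unfolding p_def by auto
      next
        case False
        have "0 \<le> b" using b[of undefined] by linarith
        then show ?thesis using False unfolding p_def by (auto simp: indicator_def)
      qed
      ultimately show ?thesis unfolding bounded_nonneg_def bounded_iff by auto
    qed
    then have "(\<lambda>\<omega>. x \<omega> - p \<omega>) \<in> claims \<Omega> A f" unfolding claims_def using x by blast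
    moreover have "(\<lambda>\<omega>. l\<^sub>0 * indicator (E \<inter> M k) \<omega>) = (\<lambda>\<omega>. (x \<omega> - p \<omega>) * indicator (E \<inter> M k) \<omega>)"
      unfolding p_def by (auto simp: indicator_def)
    ultimately have "(\<lambda>\<omega>. l\<^sub>0 * indicator (E \<inter> M k) \<omega>) \<in>
        {(\<lambda>\<omega>. x \<omega> * indicator (E \<inter> M k) \<omega>) | x. x \<in> claims \<Omega> A f}"
      by (intro CollectI exI[of _ "\<lambda>\<omega>. x \<omega> - p \<omega>"] conjI)
    moreover have "(\<lambda>\<omega>. l\<^sub>0 * indicator (E \<inter> M k) \<omega>) \<in>
        {(\<lambda>\<omega>. l * indicator (E \<inter> M k) \<omega>) | l::real. l \<ge> l\<^sub>0}"
      by (intro CollectI exI[of _ l\<^sub>0] conjI) auto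
    ultimately have "(\<lambda>\<omega>. l\<^sub>0 * indicator (E \<inter> M k) \<omega>) \<in>
        {(\<lambda>\<omega>. l * indicator (E \<inter> M k) \<omega>) | l::real. l \<ge> l\<^sub>0} \<inter>
        {(\<lambda>\<omega>. x \<omega> * indicator (E \<inter> M k) \<omega>) | x. x \<in> claims \<Omega> A f}" by (rule IntI[rotated])
    then show False unfolding not_dominated[OF U] by simp
  qed
  have "(\<lambda>k. measure Q (E \<inter> M k)) \<longlonglongrightarrow> measure Q (\<Union>k. E \<inter> M k)"
  proof (rule finite_Lim_measure_incseq)
    show "range (\<lambda>k. E \<inter> M k) \<subseteq> sets Q" using E M setsQ by auto
    have "M j \<subseteq> M k" if "j \<le> k" for j k
      unfolding M_def using order_less_le_trans[OF _ of_nat_mono[OF that]] by blast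
    then show "incseq (\<lambda>k. E \<inter> M k)" unfolding incseq_def by blast
  qed
  moreover have "\<forall>k\<ge>1. measure Q (E \<inter> M k) \<le> \<eta>" using small by auto
  ultimately have "measure Q (\<Union>k. E \<inter> M k) \<le> \<eta>" by (meson LIMSEQ_le_const2)
  moreover have "measure Q (\<Union>k. E \<inter> M k) = measure Q E"
  proof (rule finite_measure_eq_AE)
    have "AE \<omega> in Q. \<omega> \<in> (\<Union>k. M k)"
      using finite M_UN M setsQ by (intro AE_prob_1) auto
    then show "AE \<omega> in Q. \<omega> \<in> (\<Union>k. E \<inter> M k) \<longleftrightarrow> \<omega> \<in> E" by eventually_elim auto
  qed (use E M setsQ in auto)
  ultimately show ?thesis unfolding E_def by simp
qed

end

theorem theorem5:
  fixes \<Omega> :: "'a set"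
    and A :: "ennreal \<Rightarrow> 'a set set"
    and f :: "ennreal \<Rightarrow> 'a \<Rightarrow> real"
    and \<U> :: "'a set set"
  assumes nonempty: "\<Omega> \<noteq> {}"
    and algebras: "\<And>t. t < \<infinity> \<Longrightarrow> algebra \<Omega> (A t)"
    and increasing: "\<And>s t. s \<le> t \<Longrightarrow> t < \<infinity> \<Longrightarrow> A s \<subseteq> A t"
    and f_adapted: "adapted (filt \<Omega> A) f"
    and maximal_measurable: "maximal f \<in> borel_measurable (filt \<Omega> A \<infinity>)"
    and \<U>_subsets: "\<U> \<subseteq> Pow \<Omega>"
    and no_domination:
      "\<exists>l\<^sub>0>0. \<forall>U\<in>\<U>.
         {(\<lambda>\<omega>. l * indicator U \<omega>) | l::real. l \<ge> l\<^sub>0} \<inter>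
         {(\<lambda>\<omega>. x \<omega> * indicator U \<omega>) | x. x \<in> claims \<Omega> A f} = {}"
    and \<U>_bounded: "\<And>U. U \<in> \<U> \<Longrightarrow> \<exists>n::nat. n > 0 \<and> U \<subseteq> {\<omega>\<in>\<Omega>. maximal f \<omega> < of_nat n}"
    and \<U>_union: "\<And>U V. U \<in> \<U> \<Longrightarrow> V \<in> \<U> \<Longrightarrow> U \<union> V \<in> \<U>"
  shows "(\<exists>P X. P \<in> probabilities (filt \<Omega> A \<infinity>) \<and>
            supermartingale P (filt \<Omega> A) X \<and> (\<forall>t. \<forall>\<omega>\<in>\<Omega>. 0 \<le> X t \<omega>) \<and>
            quasimartingale P (filt \<Omega> A) (\<lambda>t \<omega>. X t \<omega> * f t \<omega>)) \<and>
         (\<forall>Q \<eta>. Q \<in> probabilities (filt \<Omega> A \<infinity>) \<and> \<eta> > 0 \<and>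
            measure Q {\<omega>\<in>\<Omega>. maximal f \<omega> < \<infinity>} = 1 \<and>
            (\<forall>F\<in>sets (filt \<Omega> A \<infinity>). \<forall>k::nat. k > 0 \<longrightarrow>
               measure Q (F \<inter> {\<omega>\<in>\<Omega>. maximal f \<omega> < of_nat k}) \<ge> \<eta> \<longrightarrow>
               F \<inter> {\<omega>\<in>\<Omega>. maximal f \<omega> < of_nat k} \<in> \<U>) \<longrightarrow>
            (\<forall>\<delta>>\<eta>. \<exists>P X. P \<in> probabilities (filt \<Omega> A \<infinity>) \<and>
               supermartingale P (filt \<Omega> A) X \<and> (\<forall>t. \<forall>\<omega>\<in>\<Omega>. 0 \<le> X t \<omega>) \<and>
               quasimartingale P (filt \<Omega> A) (\<lambda>t \<omega>. X t \<omega> * f t \<omega>) \<and>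
               measure P {\<omega>\<in>\<Omega>. X \<infinity> \<omega> = 0} < \<delta>))"
proof (intro conjI allI impI)
  interpret adapted_process \<Omega> A f
    by (rule adapted_process.intro) fact+
  \<comment> \<open>The density \<open>0\<close> yields the zero supermartingale, under a point mass.\<close>
  obtain \<omega>\<^sub>0 where "\<omega>\<^sub>0 \<in> \<Omega>" using nonempty by auto
  have P: "return (\<F> \<infinity>) \<omega>\<^sub>0 \<in> probabilities (\<F> \<infinity>)"
    unfolding probabilities_def using \<open>\<omega>\<^sub>0 \<in> \<Omega>\<close> by (auto intro!: prob_space_return)
  show "\<exists>P X. P \<in> probabilities (\<F> \<infinity>) \<and> supermartingale P \<F> X \<and> (\<forall>t. \<forall>\<omega>\<in>\<Omega>. 0 \<le> X t \<omega>) \<and>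
      quasimartingale P \<F> (\<lambda>t \<omega>. X t \<omega> * f t \<omega>)"
  proof (intro exI conjI)
    show "supermartingale (return (\<F> \<infinity>) \<omega>\<^sub>0) \<F> (dual_supermartingale (return (\<F> \<infinity>) \<omega>\<^sub>0) (\<lambda>_. 0))"
      by (rule dual_is_supermartingale[OF P]) auto
    show "quasimartingale (return (\<F> \<infinity>) \<omega>\<^sub>0) \<F>
        (\<lambda>t \<omega>. dual_supermartingale (return (\<F> \<infinity>) \<omega>\<^sub>0) (\<lambda>_. 0) t \<omega> * f t \<omega>)"
      by (rule dual_mult_is_quasimartingale[OF P, where c=0]) auto
  qed (use P dual_nonneg[OF P] in auto)
next
  interpret adapted_process \<Omega> A f
    by (rule adapted_process.intro) fact+
  fix Q :: "'a measure" and \<eta> \<delta> :: real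
  assume "\<eta> < \<delta>" and asm: "Q \<in> probabilities (\<F> \<infinity>) \<and> \<eta> > 0 \<and>
      measure Q {\<omega>\<in>\<Omega>. maximal f \<omega> < \<infinity>} = 1 \<and>
      (\<forall>F\<in>sets (\<F> \<infinity>). \<forall>k::nat. k > 0 \<longrightarrow>
         measure Q (F \<inter> {\<omega>\<in>\<Omega>. maximal f \<omega> < of_nat k}) \<ge> \<eta> \<longrightarrow>
         F \<inter> {\<omega>\<in>\<Omega>. maximal f \<omega> < of_nat k} \<in> \<U>)"
  then have Q: "Q \<in> probabilities (\<F> \<infinity>)" and "0 < \<eta>"
    and Q_fin: "measure Q {\<omega>\<in>\<Omega>. maximal f \<omega> < \<infinity>} = 1" by auto
  interpret Q: prob_space Q by (rule prob_space_Q[OF Q])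
  note space_Q[OF Q, simp]
  obtain l\<^sub>0 where "0 < l\<^sub>0" and l\<^sub>0: "\<And>U. U \<in> \<U> \<Longrightarrow> {(\<lambda>\<omega>. l * indicator U \<omega>) | l::real. l \<ge> l\<^sub>0} \<inter>
         {(\<lambda>\<omega>. x \<omega> * indicator U \<omega>) | x. x \<in> claims \<Omega> A f} = {}"
    using no_domination by blast
  have tail: "measure Q {\<omega>\<in>space Q. l\<^sub>0 \<le> x \<omega>} \<le> \<eta>" if "x \<in> gains A f" for x
    using gain_tail_bound[OF Q Q_fin, of \<eta> \<U> l\<^sub>0 x] asm l\<^sub>0 that by auto
  have "\<exists>z\<in>borel_measurable Q. (\<forall>\<omega>\<in>space Q. 0 \<le> z \<omega> \<and> z \<omega> \<le> 1) \<and>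
      1 - \<eta> \<le> Q.expectation z \<and>
      (\<forall>x\<in>gains A f. (\<integral>\<omega>. z \<omega> * (weight f \<omega> * x \<omega>) \<partial>Q) \<le> l\<^sub>0 + 1)"
  proof (rule Q.density_bounding_weighted_expectations[OF gains_convex])
    fix x assume "x \<in> gains A f"
    then obtain h where h: "has_elem_integral A f h x" unfolding gains_iff by blast
    show "x \<in> borel_measurable Q" by (rule filt_measurable_Q[OF Q elem_integral_measurable[OF h]])
    show "\<exists>B. \<forall>\<omega>\<in>space Q. \<bar>weight f \<omega> * x \<omega>\<bar> \<le> B" using weight_mult_integral_bounded[OF h] by blast
  qed (use tail weight_bounds[of f] filt_measurable_Q[OF Q weight_measurable] \<open>0 < l\<^sub>0\<close> \<open>0 < \<eta>\<close> in auto)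
  then obtain z where z_meas: "z \<in> borel_measurable Q" and z: "\<And>\<omega>. \<omega> \<in> \<Omega> \<Longrightarrow> 0 \<le> z \<omega> \<and> z \<omega> \<le> 1"
    and z_exp: "1 - \<eta> \<le> Q.expectation z"
    and z_gain: "\<And>x. x \<in> gains A f \<Longrightarrow> (\<integral>\<omega>. z \<omega> * (weight f \<omega> * x \<omega>) \<partial>Q) \<le> l\<^sub>0 + 1"
    by auto
  define Z where "Z \<omega> = z \<omega> * weight f \<omega>" for \<omega>
  have Z_meas: "Z \<in> borel_measurable (\<F> \<infinity>)"
  proof -
    have "z \<in> borel_measurable (\<F> \<infinity>)"
      using z_meas measurable_cong_sets[OF sets_Q[OF Q] refl] by blast
    then show ?thesis unfolding Z_def using weight_measurable by measurable
  qed
  have Z: "0 \<le> Z \<omega> \<and> Z \<omega> \<le> 1" if "\<omega> \<in> \<Omega>" for \<omega>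
    using z[OF that] weight_bounds[of f \<omega>] unfolding Z_def by (simp add: mult_le_one)
  have Zf: "\<bar>f t \<omega> * Z \<omega>\<bar> \<le> 1" if "t < \<infinity>" "\<omega> \<in> \<Omega>" for t \<omega>
  proof -
    have "\<bar>f t \<omega> * Z \<omega>\<bar> = z \<omega> * (weight f \<omega> * \<bar>f t \<omega>\<bar>)"
      using z[OF that(2)] weight_bounds[of f \<omega>] unfolding Z_def by (simp add: abs_mult ac_simps)
    also have "\<dots> \<le> 1"
      using z[OF that(2)] weight_mult_process_bounded[OF that(1), of f \<omega>] weight_bounds[of f \<omega>]
      by (intro mult_le_one[of "z \<omega>" "weight f \<omega> * \<bar>f t \<omega>\<bar>"]) auto
    finally show ?thesis .
  qed
  let ?X = "dual_supermartingale Q Z"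
  have zero: "measure Q {\<omega>\<in>\<Omega>. ?X \<infinity> \<omega> = 0} < \<delta>"
  proof -
    have X_meas: "?X \<infinity> \<in> borel_measurable Q"
      by (rule filt_measurable_Q[OF Q dual_adapted[OF Q Z_meas Z Zf]])
    have sets: "{\<omega>\<in>space Q. ?X \<infinity> \<omega> = 0} \<in> sets Q" using X_meas by measurable
    have ind: "integrable Q (indicator {\<omega>\<in>space Q. ?X \<infinity> \<omega> = 0} :: 'a \<Rightarrow> real)"
      using sets by (intro integrable_real_indicator) (auto simp: Q.emeasure_finite top.not_eq_extremum[symmetric])
    have "AE \<omega> in Q. \<omega> \<in> {\<omega>\<in>\<Omega>. maximal f \<omega> < \<infinity>}" by (rule Q.AE_prob_1[OF Q_fin])
    \<comment> \<open>The weight is positive almost surely, so \<open>X \<infinity>\<close> vanishes only where \<open>z\<close> does.\<close>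
    then have "AE \<omega> in Q. z \<omega> \<le> 1 - indicator {\<omega>\<in>space Q. ?X \<infinity> \<omega> = 0} \<omega>"
    proof eventually_elim
      fix \<omega> assume \<omega>: "\<omega> \<in> {\<omega>\<in>\<Omega>. maximal f \<omega> < \<infinity>}"
      then have "0 < weight f \<omega>" unfolding weight_def by (auto simp: add_pos_nonneg)
      then have "z \<omega> = 0" if "?X \<infinity> \<omega> = 0"
        using that unfolding dual_supermartingale_def Z_def by auto
      then show "z \<omega> \<le> 1 - indicator {\<omega>\<in>space Q. ?X \<infinity> \<omega> = 0} \<omega>"
        using z \<omega> by (auto simp: indicator_def)
    qed
    moreover have "integrable Q z"
      by (rule integrable_bounded_Q[OF Q z_meas, of 1]) (use z in auto)
    ultimately have "Q.expectation z \<le> Q.expectation (\<lambda>\<omega>. 1 - indicator {\<omega>\<in>space Q. ?X \<infinity> \<omega> = 0} \<omega>)"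
      using ind by (intro integral_mono_AE Bochner_Integration.integrable_diff) auto
    also have "\<dots> = 1 - measure Q {\<omega>\<in>\<Omega>. ?X \<infinity> \<omega> = 0}"
    proof -
      have "{\<omega>\<in>\<Omega>. ?X \<infinity> \<omega> = 0} \<inter> \<Omega> = {\<omega>\<in>\<Omega>. ?X \<infinity> \<omega> = 0}" by auto
      moreover have "measure Q \<Omega> = 1" using Q.prob_space by simp
      ultimately show ?thesis using ind by simp
    qed
    finally show ?thesis using z_exp \<open>\<eta> < \<delta>\<close> by linarith
  qed
  have "(\<integral>\<omega>. Z \<omega> * x \<omega> \<partial>Q) \<le> l\<^sub>0 + 1" if "x \<in> gains A f" for x
    using z_gain[OF that] unfolding Z_def by (simp add: mult.assoc)
  then have "quasimartingale Q \<F> (\<lambda>t \<omega>. ?X t \<omega> * f t \<omega>)"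
    by (rule dual_mult_is_quasimartingale[OF Q Z_meas, rotated 2]) (use Z Zf in auto)
  then show "\<exists>P X. P \<in> probabilities (\<F> \<infinity>) \<and> supermartingale P \<F> X \<and> (\<forall>t. \<forall>\<omega>\<in>\<Omega>. 0 \<le> X t \<omega>) \<and>
      quasimartingale P \<F> (\<lambda>t \<omega>. X t \<omega> * f t \<omega>) \<and> measure P {\<omega>\<in>\<Omega>. X \<infinity> \<omega> = 0} < \<delta>"
    using Q dual_is_supermartingale[OF Q Z_meas Z Zf] dual_nonneg[OF Q Z_meas Z Zf] zero
    by (intro exI[of _ Q] exI[of _ ?X]) auto
qed

end
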